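(* For every integer $\ell>4$ with $4\nmid \ell$, $\mathrm{ex}(n,\overrightarrow{C}_4,\overrightarrow{C}_\ell)=\left(\frac{n}{4}\right)^4+o(n^4)$.
   Context: An oriented graph is a directed graph without loops in which every pair of vertices is joined by at most one arc. $\overrightarrow{C}_m$ denotes the directed cycle of length $m$. A copy of $H$ in $G$ is a (not necessarily induced) subgraph isomorphic to $H$. $\mathrm{ex}(n,\overrightarrow{C}_k,\overrightarrow{C}_\ell)$ is the maximum number of copies of $\overrightarrow{C}_k$ in an $n$-vertex oriented graph containing no copy of $\overrightarrow{C}_\ell$. Asymptotics are as $n\to\infty$ with $\ell$ fixed. *)

theory Defs
  imports
    "HOL-Library.Landau_Symbols"
    "Graph_Theory.Digraph_Isomorphism"
begin

text \<open>
  The locale \<^locale>\<open>pair_digraph\<close> provides finiteness, well-formedness and the absence of loops;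
  parallel arcs cannot occur because arcs are pairs of vertices.
\<close>

definition oriented_graph :: "'a pair_pre_digraph \<Rightarrow> bool" where
  "oriented_graph G \<longleftrightarrow>
     pair_digraph G \<and> (\<forall>u v. (u, v) \<in> parcs G \<longrightarrow> (v, u) \<notin> parcs G)"

definition dicycle :: "nat \<Rightarrow> nat pair_pre_digraph" where
  "dicycle m = \<lparr> pverts = {..<m}, parcs = (\<lambda>i. (i, (i + 1) mod m)) ` {..<m} \<rparr>"

definition copies :: "'b pair_pre_digraph \<Rightarrow> 'a pair_pre_digraph \<Rightarrow> 'a pair_pre_digraph set" where
  "copies H G =
     {C. subgraph (with_proj C) (with_proj G) \<and> digraph_iso (with_proj H) (with_proj C)}"

text \<open>
  The maximum number of copies of \<open>H\<close> in an \<open>n\<close>-vertex oriented graph containing no copy of \<open>F\<close>.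
  Every finite graph is isomorphic to one whose vertices are natural numbers. The \<open>Max\<close> is over a
  finite set, and over a nonempty one as soon as \<open>F\<close> has an arc, see below.
\<close>

definition ex_count :: "nat \<Rightarrow> 'b pair_pre_digraph \<Rightarrow> 'c pair_pre_digraph \<Rightarrow> nat" where
  "ex_count n H F =
     Max {card (copies H G) | G :: nat pair_pre_digraph.
            oriented_graph G \<and> card (pverts G) = n \<and> copies F G = {}}"

lemma copies_subset:
  "copies H G \<subseteq> (\<lambda>(V, A). \<lparr> pverts = V, parcs = A \<rparr>) ` (Pow (pverts G) \<times> Pow (parcs G))"
proof
  fix C assume "C \<in> copies H G"
  then have "pverts C \<subseteq> pverts G" "parcs C \<subseteq> parcs G"
    by (auto simp: copies_def subgraph_def)
  then show "C \<in> (\<lambda>(V, A). \<lparr> pverts = V, parcs = A \<rparr>) ` (Pow (pverts G) \<times> Pow (parcs G))"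
    by (intro image_eqI[where x = "(pverts C, parcs C)"]) auto
qed

lemma
  assumes "oriented_graph G"
  shows finite_copies: "finite (copies H G)"
    and card_copies_le: "card (copies H G) \<le> 2 ^ card (pverts G) * 2 ^ (card (pverts G) ^ 2)"
proof -
  interpret pair_digraph G using assms by (simp add: oriented_graph_def)
  let ?S = "Pow (pverts G) \<times> Pow (parcs G)"
  have fin: "finite ?S" by (simp add: pair_finite_verts pair_finite_arcs)
  then show "finite (copies H G)"
    by (rule finite_subset[OF copies_subset finite_imageI])
  have "parcs G \<subseteq> pverts G \<times> pverts G"
    using arc_fst_in_verts arc_snd_in_verts by fastforce
  from card_mono[OF _ this] have A: "card (parcs G) \<le> card (pverts G) ^ 2"
    by (simp add: pair_finite_verts card_cartesian_product power2_eq_square)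
  have "card (copies H G) \<le> card ?S"
    using surj_card_le[OF fin copies_subset] .
  also have "\<dots> = 2 ^ card (pverts G) * 2 ^ card (parcs G)"
    by (simp add: card_cartesian_product card_Pow pair_finite_verts pair_finite_arcs)
  also have "\<dots> \<le> 2 ^ card (pverts G) * 2 ^ (card (pverts G) ^ 2)"
    using A by (intro mult_left_mono power_increasing) auto
  finally show "card (copies H G) \<le> 2 ^ card (pverts G) * 2 ^ (card (pverts G) ^ 2)" .
qed

lemma ex_count_set_finite:
  "finite {card (copies H G) | G :: nat pair_pre_digraph.
            oriented_graph G \<and> card (pverts G) = n \<and> copies F G = {}}"
  by (rule finite_subset[of _ "{..2 ^ n * 2 ^ (n ^ 2)}"]) (auto dest: card_copies_le)

lemma ex_count_set_nonempty:
  assumes "parcs F \<noteq> {}"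
  shows "{card (copies H G) | G :: nat pair_pre_digraph.
            oriented_graph G \<and> card (pverts G) = n \<and> copies F G = {}} \<noteq> {}"
proof -
  let ?G = "\<lparr> pverts = {..<n}, parcs = {} \<rparr>"
  have "oriented_graph ?G"
    unfolding oriented_graph_def by (auto intro!: pair_digraph.intro pair_fin_digraph.intro
      pair_loopfree_digraph.intro pair_wf_digraph.intro pair_fin_digraph_axioms.intro
      pair_loopfree_digraph_axioms.intro)
  moreover have "copies F ?G = {}"
  proof -
    have False if "C \<in> copies F ?G" for C
    proof -
      from that have "parcs C = {}" by (auto simp: copies_def subgraph_def)
      moreover from that obtain f where "with_proj C = app_iso f (with_proj F)"
        by (auto simp: copies_def digraph_iso_def)
      then have "parcs C = iso_arcs f ` parcs F"
        by (metis arcs_app_iso with_proj_simps(2))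
      ultimately show False using assms by simp
    qed
    then show ?thesis by blast
  qed
  ultimately show ?thesis by force
qed

end

theory Submission
  imports Defs "HOL-Analysis.Convex" "HOL-Library.FuncSet"
begin

text \<open>
  The lower bound is the balanced blow-up of the directed 4-cycle, all of whose closed walks have
  length divisible by 4.

  For the upper bound, suppose first that the graph has no closed walk of length \<open>l\<close>, and give its
  vertices nonnegative weights of total 1. If two vertices lie in no common 4-cycle, the total weight
  of the 4-cycles is affine in the way their joint weight is divided, so one of the two can be
  dropped. Eventually any two vertices lie in a common 4-cycle: each pair is an arc lying on a
  4-cycle, or an opposite pair, joined by 2-walks in both directions. Composing such walks, any
  triangle of arcs, and any arc whose ends are both opposite to a third vertex, would produce a closed
  walk of length \<open>l\<close>; hence the graph is bipartite, and two applications of AM-GM bound the weight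
  by \<open>4 ^ (- 4)\<close>.

  In a graph that merely has no \<open>l\<close>-cycle, closed \<open>l\<close>-walks without repetition do not exist, and
  repeatedly splitting a repeated vertex by Cauchy--Schwarz shows that every other type of closed
  \<open>l\<close>-walk has vanishing density. So a random sample of \<open>m\<close> vertices typically has no closed
  \<open>l\<close>-walk, and averaging the bound over samples gives the theorem.
\<close>

section \<open>Digraphs in which any two vertices share a 4-cycle\<close>

text \<open>The tuples record a starting vertex, so in an oriented graph each 4-cycle is counted
  four times. Hence the constant \<open>1 / 64 = 4 * (1 / 4) ^ 4\<close> in the bounds on this
  set.\<close>

definition closed4 :: "'a rel \<Rightarrow> ('a \<times> 'a \<times> 'a \<times> 'a) set" where
  "closed4 E = {(a, b, c, d). (a, b) \<in> E \<and> (b, c) \<in> E \<and> (c, d) \<in> E \<and> (d, a) \<in> E}"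

definition weight4 :: "'a rel \<Rightarrow> ('a \<Rightarrow> real) \<Rightarrow> real" where
  "weight4 E w = (\<Sum>(a, b, c, d) \<in> closed4 E. w a * w b * w c * w d)"

definition opposite :: "'a rel \<Rightarrow> 'a \<Rightarrow> 'a \<Rightarrow> bool" where
  "opposite E u v \<longleftrightarrow> (u, v) \<in> E ^^ 2 \<and> (v, u) \<in> E ^^ 2"

lemma opposite_sym: "opposite E u v \<Longrightarrow> opposite E v u"
  by (auto simp: opposite_def)

lemma oppositeD:
  assumes "opposite E u v" shows "(u, v) \<in> E ^^ 2" "(v, u) \<in> E ^^ 2"
  using assms by (auto simp: opposite_def)

text \<open>Most contradictions below go around three vertices: an arc contributes length 1, the way
  back along its 4-cycle 3, an opposite pair 2 in either direction, and the lengths add up to a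
  forbidden value.\<close>

lemma relpow_closed_triangle:
  assumes "\<And>x. (x, x) \<notin> E ^^ k"
    and "(x, y) \<in> E ^^ i" "(y, z) \<in> E ^^ j" "(z, x) \<in> E ^^ h" "i + j + h = k"
  shows False
  using relpow_trans[OF relpow_trans[OF assms(2,3)] assms(4)] assms(1,5) by metis

lemma relpow_2I: "(x, y) \<in> E \<Longrightarrow> (y, z) \<in> E \<Longrightarrow> (x, z) \<in> E ^^ 2"
  by (auto simp: numeral_2_eq_2)

lemma relpow_2E:
  assumes "(x, z) \<in> E ^^ 2" obtains y where "(x, y) \<in> E" "(y, z) \<in> E"
  using assms by (auto simp: numeral_2_eq_2)

lemma relpow_3E:
  assumes "(x, z) \<in> E ^^ 3" obtains p q where "(x, p) \<in> E" "(p, q) \<in> E" "(q, z) \<in> E"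
  using assms by (auto simp: numeral_3_eq_3)

lemma relpow_3I: "(x, p) \<in> E \<Longrightarrow> (p, q) \<in> E \<Longrightarrow> (q, z) \<in> E \<Longrightarrow> (x, z) \<in> E ^^ 3"
  by (auto simp: numeral_3_eq_3)

lemma relpow_1I: "(x, y) \<in> E \<Longrightarrow> (x, y) \<in> (E :: 'a rel) ^^ 1"
  by simp

locale linked_digraph =
  fixes V :: "'a set" and E :: "'a rel"
  assumes arcs_in: "E \<subseteq> V \<times> V"
    and asym: "(u, v) \<in> E \<Longrightarrow> (v, u) \<notin> E"
    and return: "(u, v) \<in> E \<Longrightarrow> (v, u) \<in> E ^^ 3"
    and linked: "u \<in> V \<Longrightarrow> v \<in> V \<Longrightarrow> u \<noteq> v \<Longrightarrow> (u, v) \<in> E \<or> (v, u) \<in> E \<or> opposite E u v"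
begin

text \<open>With arcs of length 1 and opposite pairs of length 2, the excluded triples are those of odd total length.\<close>

definition no_odd_triple :: bool where
  "no_odd_triple \<longleftrightarrow>
     (\<forall>u v w. (u, v) \<in> E \<longrightarrow> (v, w) \<in> E \<longrightarrow> (u, w) \<notin> E \<and> (w, u) \<notin> E) \<and>
     (\<forall>u v w. (u, v) \<in> E \<longrightarrow> opposite E u w \<longrightarrow> \<not> opposite E v w)"

lemma in_V: "(u, v) \<in> E \<Longrightarrow> u \<in> V" "(u, v) \<in> E \<Longrightarrow> v \<in> V"
  using arcs_in by auto

text \<open>The case of \<open>l\<close> congruent to 1 modulo 4. A transitive triangle closes up
  with length 1 + 1 + 3, and an arc with two opposite pairs with length 1 + 2 + 2.\<close>

lemma no_odd_triple_if_no_closed_5: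
  assumes no5: "\<And>x. (x, x) \<notin> E ^^ 5"
  shows no_odd_triple
proof -
  note cl = relpow_closed_triangle[OF no5]
  have trans: False if "(u, v) \<in> E" "(v, w) \<in> E" "(u, w) \<in> E" for u v w
    using cl[OF relpow_1I[OF that(1)] relpow_1I[OF that(2)] return[OF that(3)]] by simp
  have opp: False if "(u, v) \<in> E" "opposite E u w" "opposite E v w" for u v w
    using cl[OF relpow_1I[OF that(1)] oppositeD(1)[OF that(3)] oppositeD(2)[OF that(2)]] by simp
  \<comment> \<open>A directed triangle is reduced to the other two configurations: on a 4-cycle
    \<open>u v p q\<close>, the vertex \<open>p\<close> is opposite to \<open>u\<close>. An arc
    between \<open>p\<close> and \<open>w\<close> would give a transitive triangle with
    \<open>v\<close>, so \<open>p\<close> is opposite to \<open>w\<close> too, against the arc from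
    \<open>w\<close> to \<open>u\<close>.\<close>
  have cyc: False if uv: "(u, v) \<in> E" and vw: "(v, w) \<in> E" and wu: "(w, u) \<in> E" for u v w
  proof -
    obtain p q where pq: "(v, p) \<in> E" "(p, q) \<in> E" "(q, u) \<in> E"
      using relpow_3E[OF return[OF uv]] by metis
    have up: "opposite E u p"
      unfolding opposite_def using relpow_2I[OF uv pq(1)] relpow_2I[OF pq(2,3)] by simp
    have "p \<noteq> w" using trans[OF _ pq(3) wu] pq(2) by blast
    then have "opposite E p w"
      using linked[OF in_V(2)[OF pq(1)] in_V(2)[OF vw]] trans[OF pq(1) _ vw] trans[OF vw _ pq(1)]
      by blast
    then show False using opp[OF wu opposite_sym up] by blast
  qed
  show ?thesis unfolding no_odd_triple_def
    by (intro conjI allI impI notI; erule (2) trans cyc opp)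
qed

text \<open>The case of \<open>l\<close> congruent to 3 modulo 4. Here a transitive triangle closes
  up with length 1 + 3 + 3, an arc with two opposite pairs with length 3 + 2 + 2, and a directed
  triangle is itself a closed 3-walk.\<close>

lemma no_odd_triple_if_no_closed_3_7:
  assumes no3: "\<And>x. (x, x) \<notin> E ^^ 3" and no7: "\<And>x. (x, x) \<notin> E ^^ 7"
  shows no_odd_triple
proof -
  note cl = relpow_closed_triangle[OF no7]
  have trans: False if "(u, v) \<in> E" "(v, w) \<in> E" "(u, w) \<in> E" for u v w
    using cl[OF relpow_1I[OF that(3)] return[OF that(2)] return[OF that(1)]] by simp
  have opp: False if "(u, v) \<in> E" "opposite E u w" "opposite E v w" for u v w
    using cl[OF return[OF that(1)] oppositeD(1)[OF that(2)] oppositeD(2)[OF that(3)]] by simp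
  have cyc: False if "(u, v) \<in> E" "(v, w) \<in> E" "(w, u) \<in> E" for u v w
    using relpow_3I[OF that] no3 by blast
  show ?thesis unfolding no_odd_triple_def
    by (intro conjI allI impI notI; erule (2) trans cyc opp)
qed

text \<open>The case of \<open>l\<close> congruent to 2 modulo 4. The walks used so far around an
  odd triple have odd length and exclude nothing here, so 4-cycles through its arcs are added and
  \<open>linked\<close> is used to force relations between the new vertices, the alternatives mostly
  giving closed walks of length 1 + 2 + 3 or 2 + 2 + 2.\<close>

lemma no_odd_triple_if_no_closed_3_6:
  assumes no3: "\<And>x. (x, x) \<notin> E ^^ 3" and no6: "\<And>x. (x, x) \<notin> E ^^ 6"
  shows no_odd_triple
proof -
  note cl6 = relpow_closed_triangle[OF no6]
  have cyc: False if "(u, v) \<in> E" "(v, w) \<in> E" "(w, u) \<in> E" for u v w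
    using relpow_3I[OF that] no3 by blast
  have arc_not_opp: False if "(u, v) \<in> E" "opposite E u v" for u v
    using oppositeD(2)[OF that(2)] cyc[OF that(1)] by (elim relpow_2E)
  have opp3: False if "opposite E u v" "opposite E v w" "opposite E w u" for u v w
    using cl6[OF that[THEN oppositeD(1)]] by simp
  have arc_opp: False if "(y, z) \<in> E" "(x, y) \<in> E ^^ 2" "(z, x) \<in> E ^^ 3" for x y z
    using cl6[OF that(2) relpow_1I[OF that(1)] that(3)] by simp
  have arc_opp': False if "(y, z) \<in> E" "(z, x) \<in> E ^^ 2" "(x, y) \<in> E ^^ 3" for x y z
    using cl6[OF relpow_1I[OF that(1)] that(2,3)] by simp
  \<comment> \<open>The 4-cycles \<open>u v p q\<close> and \<open>v w r s\<close> force the arcs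
    from \<open>w\<close> to \<open>p\<close> and from \<open>p\<close> to \<open>r\<close>, and
    make \<open>u\<close> and \<open>r\<close> opposite.\<close>
  have trans: False if uv: "(u, v) \<in> E" and vw: "(v, w) \<in> E" and uw: "(u, w) \<in> E" for u v w
  proof -
    obtain p q where pq: "(v, p) \<in> E" "(p, q) \<in> E" "(q, u) \<in> E"
      using relpow_3E[OF return[OF uv]] by metis
    obtain r s where rs: "(w, r) \<in> E" "(r, s) \<in> E" "(s, v) \<in> E"
      using relpow_3E[OF return[OF vw]] by metis
    have V: "u \<in> V" "w \<in> V" "p \<in> V" "r \<in> V"
      using in_V(1)[OF uw] in_V(2)[OF uw] in_V(1)[OF pq(2)] in_V(1)[OF rs(2)] by auto
    have up: "opposite E u p"
      unfolding opposite_def using relpow_2I[OF uv pq(1)] relpow_2I[OF pq(2,3)] by simp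
    have vr: "opposite E v r"
      unfolding opposite_def using relpow_2I[OF vw rs(1)] relpow_2I[OF rs(2,3)] by simp
    have wp: "(w, p) \<in> E"
    proof -
      have "w \<noteq> p" using arc_not_opp[OF uw] up by blast
      moreover have "(p, w) \<notin> E"
        using arc_opp[of p w u] oppositeD[OF up] return[OF uw] by blast
      moreover have "\<not> opposite E w p"
        using arc_opp'[OF vw _ return[OF pq(1)]] by (auto simp: opposite_def)
      ultimately show ?thesis using linked[of w p] V by blast
    qed
    have ur: "opposite E u r"
    proof -
      have "u \<noteq> r" using asym[OF uw] rs by blast
      moreover have "(r, u) \<notin> E" using cyc[OF uw rs(1)] by blast
      moreover have "(u, r) \<notin> E"
        using arc_opp'[OF _ oppositeD(2)[OF vr] return[OF uv]] by blast
      ultimately show ?thesis using linked[of u r] V by blast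
    qed
    have pr: "(p, r) \<in> E"
    proof -
      have "p \<noteq> r" using arc_not_opp[OF pq(1)] vr by blast
      moreover have "(r, p) \<notin> E"
        using arc_opp[OF _ oppositeD(1)[OF vr] return[OF pq(1)]] by blast
      moreover have "\<not> opposite E p r"
        using arc_opp'[OF rs(1) _ return[OF wp]] by (auto simp: opposite_def)
      ultimately show ?thesis using linked[of p r] V by blast
    qed
    \<comment> \<open>The closed 6-walk goes from \<open>p\<close> to \<open>r\<close> by an arc, on
      to \<open>u\<close> in two steps, and back through \<open>v\<close> and \<open>w\<close> to
      \<open>p\<close>.\<close>
    show False
      using arc_opp'[OF pr oppositeD(2)[OF ur] relpow_3I[OF uv vw wp]] .
  qed
  \<comment> \<open>On a 4-cycle \<open>u v p q\<close>, the vertex \<open>w\<close> is forced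
    between \<open>p\<close> and \<open>q\<close>, which gives a transitive triangle.\<close>
  have opp: False if uv: "(u, v) \<in> E" and uw: "opposite E u w" and vw: "opposite E v w" for u v w
  proof -
    obtain p q where pq: "(v, p) \<in> E" "(p, q) \<in> E" "(q, u) \<in> E"
      using relpow_3E[OF return[OF uv]] by metis
    have "w \<in> V" using oppositeD(1)[OF vw] in_V(2) by (rule relpow_2E)
    then have V: "w \<in> V" "p \<in> V" "q \<in> V"
      using in_V(1)[OF pq(2)] in_V(2)[OF pq(2)] by auto
    have up: "opposite E u p" and vq: "opposite E v q"
      unfolding opposite_def
      using relpow_2I[OF uv pq(1)] relpow_2I[OF pq(2,3)] relpow_2I[OF pq(1,2)] relpow_2I[OF pq(3) uv]
      by simp_all
    have "(p, w) \<in> E"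
    proof -
      have "p \<noteq> w" using arc_not_opp[OF pq(1)] vw by blast
      moreover have "(w, p) \<notin> E"
        using arc_opp[OF _ oppositeD(1)[OF vw] return[OF pq(1)]] by blast
      moreover have "\<not> opposite E p w" using opp3[of p w u] up uw by (auto dest: opposite_sym)
      ultimately show ?thesis using linked[of p w] V by blast
    qed
    moreover have "(w, q) \<in> E"
    proof -
      have "w \<noteq> q" using arc_not_opp[of q u] pq uw by (auto dest: opposite_sym)
      moreover have "(q, w) \<notin> E"
        using arc_opp'[OF _ oppositeD(2)[OF uw] return[OF pq(3)]] by blast
      moreover have "\<not> opposite E w q" using opp3[of w q v] vq vw by (auto dest: opposite_sym)
      ultimately show ?thesis using linked[of w q] V by blast
    qed
    ultimately show False using trans[OF _ _ pq(2)] by blast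
  qed
  show ?thesis unfolding no_odd_triple_def
    by (intro conjI allI impI notI; erule (2) trans cyc opp)
qed

text \<open>One side consists of the neighbours of a fixed vertex \<open>x\<close>. An arc inside it
  would form a triangle with \<open>x\<close>; an arc outside it avoids \<open>x\<close>, so both
  its ends would be opposite to \<open>x\<close>.\<close>

lemma bipartite_if_no_odd_triple:
  assumes no_odd_triple
  obtains A where "A \<subseteq> V" "E \<subseteq> A \<times> (V - A) \<union> (V - A) \<times> A"
proof (cases "V = {}")
  case True
  then show ?thesis using that[of "{}"] arcs_in by auto
next
  case False
  then obtain x where x: "x \<in> V" by blast
  define B where "B = {y \<in> V. (x, y) \<in> E \<or> (y, x) \<in> E}"
  have "u \<in> B \<longleftrightarrow> v \<notin> B" if uv: "(u, v) \<in> E" for u v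
  proof -
    have "\<not> (u \<in> B \<and> v \<in> B)"
      using assms uv unfolding no_odd_triple_def B_def by blast
    moreover have "u \<in> B \<or> v \<in> B"
    proof (rule ccontr)
      assume neg: "\<not> (u \<in> B \<or> v \<in> B)"
      have "u \<noteq> x" "v \<noteq> x" using uv neg in_V[OF uv] by (auto simp: B_def)
      then have "opposite E u x" "opposite E v x"
        using linked[of u x] linked[of v x] neg x in_V[OF uv] by (auto simp: B_def)
      then show False using assms uv unfolding no_odd_triple_def by blast
    qed
    ultimately show ?thesis by blast
  qed
  then have "E \<subseteq> B \<times> (V - B) \<union> (V - B) \<times> B" using arcs_in by auto
  moreover have "B \<subseteq> V" by (auto simp: B_def)
  ultimately show ?thesis using that by blast
qed

end

text \<open>A closed walk can be lengthened by 4 by running once around a 4-cycle through its base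
  point. So excluding length \<open>l\<close> excludes every smaller positive length in the same
  class modulo 4, and the classes 1, 2, 3 are settled by the short lengths above.\<close>

lemma linked_digraph_bipartite:
  assumes "linked_digraph V E" and no: "\<And>x. (x, x) \<notin> E ^^ l" and l: "l > 4" "\<not> 4 dvd l"
  obtains A where "A \<subseteq> V" "E \<subseteq> A \<times> (V - A) \<union> (V - A) \<times> A"
proof -
  interpret linked_digraph V E by fact
  have four: "(x, x) \<in> E ^^ (4 * k)" if "(x, y) \<in> E" for x y k
  proof (induction k)
    case (Suc k)
    have "(x, x) \<in> E ^^ 4" using relpow_trans[OF relpow_1I[OF that] return[OF that]] by simp
    from relpow_trans[OF this Suc] show ?case by simp
  qed simp
  have out: "\<exists>y. (x, y) \<in> E" if "(x, x) \<in> E ^^ j" "j > 0" for x j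
    using that relpow_Suc_D2[of x x "j - 1" E] by auto
  have red: "(x, x) \<notin> E ^^ j" if j: "j > 0" and jk: "j + 4 * k = l" for x j k
  proof
    assume "(x, x) \<in> E ^^ j"
    moreover from this obtain y where "(x, y) \<in> E" using out j by blast
    ultimately have "(x, x) \<in> E ^^ (j + 4 * k)" using four by (blast intro: relpow_trans)
    then show False using no jk by simp
  qed
  have red': "(x, x) \<notin> E ^^ j" if "j > 0" "j \<le> l" "j mod 4 = l mod 4" for x j
  proof -
    have "j + 4 * ((l - j) div 4) = l"
      using that by (metis dvd_mult_div_cancel le_add_diff_inverse mod_eq_dvd_iff_nat)
    then show ?thesis using red that(1) by blast
  qed
  have "l mod 4 \<noteq> 0" using l by (simp add: dvd_eq_mod_eq_0)
  then consider "l mod 4 = 1" | "l mod 4 = 2" | "l mod 4 = 3" by linarith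
  then have no_odd_triple
  proof cases
    case 1
    then show ?thesis using red'[of 5] l by (intro no_odd_triple_if_no_closed_5) auto
  next
    case 2
    then have "l \<ge> 6" using l by presburger
    then have no6: "(x, x) \<notin> E ^^ 6" for x using red'[of 6] 2 by auto
    \<comment> \<open>A closed 3-walk traversed twice is a closed 6-walk.\<close>
    moreover have "(x, x) \<notin> E ^^ 3" for x
      using no6 relpow_trans[of x x 3 E x 3] by auto
    ultimately show ?thesis by (intro no_odd_triple_if_no_closed_3_6)
  next
    case 3
    then have "l \<ge> 7" using l by presburger
    then show ?thesis using red'[of 7] red'[of 3] 3 by (intro no_odd_triple_if_no_closed_3_7) auto
  qed
  then show ?thesis using bipartite_if_no_odd_triple that by blast
qed

section \<open>The weighted bound\<close>

lemma finite_closed4: "finite E \<Longrightarrow> finite (closed4 E)"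
  by (rule finite_subset[of _ "Field E \<times> Field E \<times> Field E \<times> Field E"])
     (auto simp: closed4_def finite_Field intro: FieldI1 FieldI2)

text \<open>Fixing the diagonal \<open>a\<close>, \<open>c\<close> decouples \<open>b\<close> from
  \<open>d\<close>, so the inner sum factors into the weights of the 2-walks in the two
  directions.\<close>

lemma weight4_eq_sum:
  assumes "finite V" "E \<subseteq> V \<times> V"
  shows "weight4 E w = (\<Sum>a\<in>V. \<Sum>c\<in>V. w a * w c *
           (\<Sum>b\<in>V. if (a, b) \<in> E \<and> (b, c) \<in> E then w b else 0) *
           (\<Sum>d\<in>V. if (c, d) \<in> E \<and> (d, a) \<in> E then w d else 0))"
proof -
  let ?f = "\<lambda>a b c d. if (a, b) \<in> E \<and> (b, c) \<in> E \<and> (c, d) \<in> E \<and> (d, a) \<in> E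
    then w a * w b * w c * w d else 0"
  have "weight4 E w = (\<Sum>(a, b, c, d) \<in> V \<times> V \<times> V \<times> V. ?f a b c d)"
    unfolding weight4_def using assms
    by (intro sum.mono_neutral_cong_left) (auto simp: closed4_def split: if_splits)
  also have "\<dots> = (\<Sum>a\<in>V. \<Sum>b\<in>V. \<Sum>c\<in>V. \<Sum>d\<in>V. ?f a b c d)"
    by (simp add: sum.cartesian_product)
  also have "\<dots> = (\<Sum>a\<in>V. \<Sum>c\<in>V. \<Sum>b\<in>V. \<Sum>d\<in>V. ?f a b c d)"
    by (intro sum.cong refl sum.swap)
  also have "\<dots> = (\<Sum>a\<in>V. \<Sum>c\<in>V. w a * w c *
           (\<Sum>b\<in>V. if (a, b) \<in> E \<and> (b, c) \<in> E then w b else 0) *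
           (\<Sum>d\<in>V. if (c, d) \<in> E \<and> (d, a) \<in> E then w d else 0))"
    unfolding mult.assoc unfolding sum_product unfolding sum_distrib_left
    by (intro sum.cong refl) auto
  finally show ?thesis .
qed

lemma mult_le_quarter_square: "4 * (x * y) \<le> (x + y)\<^sup>2" for x y :: real
  using zero_le_power2[of "x - y"] by (simp add: power2_eq_square algebra_simps)

text \<open>The first AM-GM is over the middle vertices: by asymmetry none serves both directions
  between \<open>a\<close> and \<open>c\<close>, so \<open>X a c + X c a\<close> is at most
  \<open>sum w B\<close>. The second is over the ends of the 2-walks through a fixed
  \<open>b\<close>, whose in-weight and out-weight add up to at most \<open>sum w A\<close>.\<close>

lemma weight4_half_bound:
  fixes w :: "'a \<Rightarrow> real"
  assumes w: "\<And>x. w x \<ge> 0"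
    and asym: "\<And>u v. (u, v) \<in> E \<Longrightarrow> (v, u) \<notin> E"
  shows "(\<Sum>a\<in>A. \<Sum>c\<in>A. w a * w c *
           (\<Sum>b\<in>B. if (a, b) \<in> E \<and> (b, c) \<in> E then w b else 0) *
           (\<Sum>d\<in>B. if (c, d) \<in> E \<and> (d, a) \<in> E then w d else 0))
         \<le> (sum w A)\<^sup>2 * (sum w B)\<^sup>2 / 8"
proof -
  define X where "X a c = (\<Sum>b\<in>B. if (a, b) \<in> E \<and> (b, c) \<in> E then w b else 0)" for a c
  have X0: "X a c \<ge> 0" for a c unfolding X_def by (intro sum_nonneg) (auto simp: w)
  have XX: "X a c + X c a \<le> sum w B" for a c
  proof -
    show ?thesis
      unfolding X_def sum.distrib[symmetric] using asym w by (intro sum_mono) auto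
  qed
  \<comment> \<open>Only one factor is replaced by \<open>sum w B\<close>; replacing both would lose
    a factor of 2 after summation.\<close>
  have pair: "X a c * X c a \<le> sum w B / 4 * (X a c + X c a)" for a c
  proof -
    have "4 * (X a c * X c a) \<le> (X a c + X c a)\<^sup>2" by (rule mult_le_quarter_square)
    also have "\<dots> \<le> sum w B * (X a c + X c a)"
      unfolding power2_eq_square using XX X0 by (intro mult_right_mono) auto
    finally show ?thesis by simp
  qed
  have path: "(\<Sum>a\<in>A. \<Sum>c\<in>A. w a * w c * X a c) \<le> sum w B * ((sum w A)\<^sup>2 / 4)"
  proof -
    define i where "i b = (\<Sum>a\<in>A. if (a, b) \<in> E then w a else 0)" for b
    define j where "j b = (\<Sum>c\<in>A. if (b, c) \<in> E then w c else 0)" for b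
    have "(\<Sum>a\<in>A. \<Sum>c\<in>A. w a * w c * X a c) =
        (\<Sum>a\<in>A. \<Sum>c\<in>A. \<Sum>b\<in>B. w b * ((if (a, b) \<in> E then w a else 0) * (if (b, c) \<in> E then w c else 0)))"
      unfolding X_def sum_distrib_left by (intro sum.cong refl) auto
    also have "\<dots> = (\<Sum>a\<in>A. \<Sum>b\<in>B. \<Sum>c\<in>A. w b * ((if (a, b) \<in> E then w a else 0) * (if (b, c) \<in> E then w c else 0)))"
      by (intro sum.cong refl sum.swap)
    also have "\<dots> = (\<Sum>b\<in>B. \<Sum>a\<in>A. \<Sum>c\<in>A. w b * ((if (a, b) \<in> E then w a else 0) * (if (b, c) \<in> E then w c else 0)))"
      by (rule sum.swap)
    also have "\<dots> = (\<Sum>b\<in>B. w b * (i b * j b))"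
      unfolding i_def j_def sum_product unfolding sum_distrib_left ..
    also have "\<dots> \<le> (\<Sum>b\<in>B. w b * ((sum w A)\<^sup>2 / 4))"
    proof (intro sum_mono mult_left_mono w)
      fix b
      have ij: "i b \<ge> 0" "j b \<ge> 0" unfolding i_def j_def by (auto intro!: sum_nonneg w)
      have "i b + j b \<le> sum w A"
        unfolding i_def j_def sum.distrib[symmetric] using asym w by (intro sum_mono) auto
      then have "(i b + j b)\<^sup>2 \<le> (sum w A)\<^sup>2" using ij by (intro power_mono) auto
      then show "i b * j b \<le> (sum w A)\<^sup>2 / 4" using mult_le_quarter_square[of "i b" "j b"] by simp
    qed
    finally show ?thesis unfolding sum_distrib_right .
  qed
  have lin: "(\<Sum>a\<in>A. \<Sum>c\<in>A. w a * w c * (t * (X a c + X c a))) =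
      t * ((\<Sum>a\<in>A. \<Sum>c\<in>A. w a * w c * X a c) + (\<Sum>a\<in>A. \<Sum>c\<in>A. w a * w c * X c a))" for t
    unfolding sum.distrib[symmetric] sum_distrib_left by (simp add: algebra_simps)
  have B0: "sum w B \<ge> 0" by (intro sum_nonneg w)
  have "(\<Sum>a\<in>A. \<Sum>c\<in>A. w a * w c * X a c * X c a)
      \<le> (\<Sum>a\<in>A. \<Sum>c\<in>A. w a * w c * (sum w B / 4 * (X a c + X c a)))"
    unfolding mult.assoc using pair w by (intro sum_mono mult_left_mono) auto
  also have "\<dots> = sum w B / 4 * ((\<Sum>a\<in>A. \<Sum>c\<in>A. w a * w c * X a c) + (\<Sum>a\<in>A. \<Sum>c\<in>A. w a * w c * X c a))"
    by (rule lin)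
  also have "(\<Sum>a\<in>A. \<Sum>c\<in>A. w a * w c * X c a) = (\<Sum>a\<in>A. \<Sum>c\<in>A. w a * w c * X a c)"
    by (subst sum.swap) (simp add: mult.commute)
  also have "sum w B / 4 * ((\<Sum>a\<in>A. \<Sum>c\<in>A. w a * w c * X a c) + (\<Sum>a\<in>A. \<Sum>c\<in>A. w a * w c * X a c))
      \<le> sum w B / 4 * (sum w B * ((sum w A)\<^sup>2 / 4) + sum w B * ((sum w A)\<^sup>2 / 4))"
    using path B0 by (intro mult_left_mono add_mono) auto
  also have "\<dots> = (sum w A)\<^sup>2 * (sum w B)\<^sup>2 / 8"
    by (simp add: power2_eq_square field_simps)
  finally show ?thesis unfolding X_def .
qed

text \<open>Closed 4-walks alternate between the sides, so the diagonal \<open>a\<close>,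
  \<open>c\<close> lies in one side and \<open>b\<close>, \<open>d\<close> in the other. Each choice
  of side gives the half bound, and the product of the side weights is largest for equal
  sides.\<close>

lemma weight4_bipartite_le:
  fixes w :: "'a \<Rightarrow> real"
  assumes fin: "finite V" and A: "A \<subseteq> V" and E: "E \<subseteq> A \<times> (V - A) \<union> (V - A) \<times> A"
    and w: "\<And>x. w x \<ge> 0" and asym: "\<And>u v. (u, v) \<in> E \<Longrightarrow> (v, u) \<notin> E"
  shows "weight4 E w \<le> (sum w V) ^ 4 / 64"
proof -
  define B where "B = V - A"
  have V: "V = A \<union> B" "A \<inter> B = {}" and finAB: "finite A" "finite B"
    using A fin by (auto simp: B_def intro: finite_subset)
  have E': "\<And>x y. (x, y) \<in> E \<Longrightarrow> x \<in> A \<and> y \<in> B \<or> x \<in> B \<and> y \<in> A" using E by (auto simp: B_def)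
  let ?X = "\<lambda>S a c. \<Sum>b\<in>S. if (a, b) \<in> E \<and> (b, c) \<in> E then w b else 0"
  let ?h = "\<lambda>S a c. w a * w c * ?X S a c * ?X S c a"
  have split: "?X V a c = ?X A a c + ?X B a c" for a c
    unfolding V(1) by (rule sum.union_disjoint) (use finAB V in auto)
  have AX: "?X A a c = 0" if "a \<in> A \<or> c \<in> A" for a c
    using that E' V(2) by (intro sum.neutral) auto
  have BX: "?X B a c = 0" if "a \<in> B \<or> c \<in> B" for a c
    using that E' V(2) by (intro sum.neutral) auto
  have "weight4 E w = (\<Sum>a\<in>V. \<Sum>c\<in>V. ?h V a c)"
    by (rule weight4_eq_sum) (use fin E A in auto)
  also have "\<dots> = (\<Sum>a\<in>A. \<Sum>c\<in>A. ?h V a c) + (\<Sum>a\<in>A. \<Sum>c\<in>B. ?h V a c)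
      + ((\<Sum>a\<in>B. \<Sum>c\<in>A. ?h V a c) + (\<Sum>a\<in>B. \<Sum>c\<in>B. ?h V a c))"
    using finAB V(2) by (simp only: V(1) sum.union_disjoint sum.distrib)
  also have "\<dots> = (\<Sum>a\<in>A. \<Sum>c\<in>A. ?h B a c) + (\<Sum>a\<in>B. \<Sum>c\<in>B. ?h A a c)"
    by (simp add: split AX BX)
  also have "\<dots> \<le> (sum w A)\<^sup>2 * (sum w B)\<^sup>2 / 8 + (sum w B)\<^sup>2 * (sum w A)\<^sup>2 / 8"
    by (intro add_mono weight4_half_bound w asym)
  also have "\<dots> = (sum w A * sum w B)\<^sup>2 / 4" by (simp add: power_mult_distrib)
  also have "\<dots> \<le> ((sum w V)\<^sup>2 / 4)\<^sup>2 / 4"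
  proof -
    have "sum w V = sum w A + sum w B" using finAB V by (simp add: sum.union_disjoint)
    then have "sum w A * sum w B \<le> (sum w V)\<^sup>2 / 4"
      using mult_le_quarter_square[of "sum w A" "sum w B"] by simp
    then show ?thesis by (intro divide_right_mono power_mono mult_nonneg_nonneg sum_nonneg w) auto
  qed
  also have "\<dots> = (sum w V) ^ 4 / 64" by (simp add: power_divide flip: power_mult)
  finally show ?thesis .
qed

section \<open>Merging the weights of vertices that share no 4-cycle\<close>

definition in_common4 :: "'a rel \<Rightarrow> 'a \<Rightarrow> 'a \<Rightarrow> bool" where
  "in_common4 E u v \<longleftrightarrow> (\<exists>a b c d. (a, b, c, d) \<in> closed4 E \<and> {u, v} \<subseteq> {a, b, c, d})"

text \<open>Arcs on no closed 4-walk contribute nothing to \<open>weight4\<close> but would violate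
  \<open>return\<close>; passing to the core discards them.\<close>

definition core4 :: "'a rel \<Rightarrow> 'a rel" where
  "core4 E = {(a, b). \<exists>c d. (a, b, c, d) \<in> closed4 E}"

lemma core4_subset: "core4 E \<subseteq> E"
  by (auto simp: core4_def closed4_def)

lemma closed4_core4: "closed4 (core4 E) = closed4 E"
proof
  show "closed4 (core4 E) \<subseteq> closed4 E" using core4_subset by (fastforce simp: closed4_def)
  show "closed4 E \<subseteq> closed4 (core4 E)"
    by (auto simp: closed4_def core4_def)
qed

text \<open>Two distinct vertices of a closed 4-walk are either consecutive, hence joined by an arc,
  or diagonal, hence opposite.\<close>

lemma linked_digraph_core4:
  assumes E: "E \<subseteq> V \<times> V" and asym: "\<And>u v. (u, v) \<in> E \<Longrightarrow> (v, u) \<notin> E"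
    and common: "\<And>u v. u \<in> V \<Longrightarrow> v \<in> V \<Longrightarrow> u \<noteq> v \<Longrightarrow> in_common4 E u v"
  shows "linked_digraph V (core4 E)"
proof
  let ?E = "core4 E"
  show "?E \<subseteq> V \<times> V" using core4_subset E by blast
  show "(v, u) \<notin> ?E" if "(u, v) \<in> ?E" for u v using that asym core4_subset by blast
  have c4: "(a, b) \<in> ?E \<and> (b, c) \<in> ?E \<and> (c, d) \<in> ?E \<and> (d, a) \<in> ?E"
    if "(a, b, c, d) \<in> closed4 E" for a b c d
  proof -
    have "(a, b, c, d) \<in> closed4 ?E" using that by (simp add: closed4_core4)
    then show ?thesis by (simp add: closed4_def)
  qed
  show "(v, u) \<in> ?E ^^ 3" if "(u, v) \<in> ?E" for u v
  proof -
    from that obtain c d where "(u, v, c, d) \<in> closed4 E" by (auto simp: core4_def)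
    from c4[OF this] show ?thesis by (blast intro: relpow_3I)
  qed
  show "(u, v) \<in> ?E \<or> (v, u) \<in> ?E \<or> opposite ?E u v" if uv: "u \<in> V" "v \<in> V" "u \<noteq> v" for u v
  proof -
    obtain a b c d where q: "(a, b, c, d) \<in> closed4 E" "{u, v} \<subseteq> {a, b, c, d}"
      using common[OF uv] by (auto simp: in_common4_def)
    have ac: "opposite ?E a c" and bd: "opposite ?E b d"
      unfolding opposite_def using c4[OF q(1)] by (blast intro: relpow_2I)+
    show ?thesis using q(2) uv(3) c4[OF q(1)] ac bd ac[THEN opposite_sym] bd[THEN opposite_sym]
      by auto
  qed
qed

lemma relpow_mono_set: "E \<subseteq> F \<Longrightarrow> E ^^ k \<subseteq> F ^^ k" for E F :: "'a rel"
  by (induction k) auto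

lemma closed4_distinct:
  assumes "\<And>u v. (u, v) \<in> E \<Longrightarrow> (v, u) \<notin> E" "(a, b, c, d) \<in> closed4 E"
  shows "a \<noteq> b" "a \<noteq> c" "a \<noteq> d" "b \<noteq> c" "b \<noteq> d" "c \<noteq> d"
  using assms by (auto simp: closed4_def)

text \<open>A closed 4-walk meets at most one of \<open>u\<close>, \<open>v\<close>, and that one once, so the weight is affine
  along the segment on which \<open>w u + w v\<close> is constant.\<close>

lemma weight4_shift:
  fixes w :: "'a \<Rightarrow> real"
  assumes asym: "\<And>u v. (u, v) \<in> E \<Longrightarrow> (v, u) \<notin> E" and "u \<noteq> v" and no: "\<not> in_common4 E u v"
  shows "(w u + w v) * weight4 E w =
     w u * weight4 E (w(u := w u + w v, v := 0)) + w v * weight4 E (w(v := w u + w v, u := 0))"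
proof -
  let ?w1 = "w(u := w u + w v, v := 0)" and ?w2 = "w(v := w u + w v, u := 0)"
  have "(w u + w v) * (w a * w b * w c * w d) =
     w u * (?w1 a * ?w1 b * ?w1 c * ?w1 d) + w v * (?w2 a * ?w2 b * ?w2 c * ?w2 d)"
    if q: "(a, b, c, d) \<in> closed4 E" for a b c d
  proof -
    have "\<not> (u \<in> {a, b, c, d} \<and> v \<in> {a, b, c, d})" using q no unfolding in_common4_def by blast
    then consider "u \<notin> {a, b, c, d}" "v \<notin> {a, b, c, d}"
      | "u \<in> {a, b, c, d}" "v \<notin> {a, b, c, d}" | "v \<in> {a, b, c, d}" "u \<notin> {a, b, c, d}"
      by argo
    then show ?thesis
    proof cases
      case 1
      then have "a \<noteq> u" "b \<noteq> u" "c \<noteq> u" "d \<noteq> u" "a \<noteq> v" "b \<noteq> v" "c \<noteq> v" "d \<noteq> v" by auto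
      then show ?thesis by (simp add: distrib_right)
    next
      case 2
      then have v: "a \<noteq> v" "b \<noteq> v" "c \<noteq> v" "d \<noteq> v" by auto
      from 2(1) show ?thesis using v closed4_distinct[OF asym q]
        by (elim insertE emptyE) simp_all
    next
      case 3
      then have u: "a \<noteq> u" "b \<noteq> u" "c \<noteq> u" "d \<noteq> u" by auto
      from 3(1) show ?thesis using u closed4_distinct[OF asym q]
        by (elim insertE emptyE) simp_all
    qed
  qed
  then show ?thesis
    unfolding weight4_def sum_distrib_left sum.distrib[symmetric]
    by (intro sum.cong) auto
qed

lemma weight4_remove:
  fixes w :: "'a \<Rightarrow> real"
  assumes "finite E" "w v = 0"
  shows "weight4 E w = weight4 (E \<inter> (- {v}) \<times> (- {v})) w"
  unfolding weight4_def using assms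
  by (intro sum.mono_neutral_right finite_closed4) (auto simp: closed4_def)

text \<open>Induction on the number of vertices. If some pair shares no 4-cycle,
  \<open>weight4_shift\<close> makes the weight a convex combination of two weights with the same
  total, each vanishing at one vertex of the pair. Otherwise the core is a
  \<open>linked_digraph\<close>, hence bipartite.\<close>

lemma weight4_le:
  fixes w :: "'a \<Rightarrow> real"
  assumes "finite V" and "E \<subseteq> V \<times> V" and "\<And>x. w x \<ge> 0"
    and "\<And>u v. (u, v) \<in> E \<Longrightarrow> (v, u) \<notin> E"
    and "\<And>x. (x, x) \<notin> E ^^ l" and "l > 4" "\<not> 4 dvd l"
  shows "weight4 E w \<le> (sum w V) ^ 4 / 64"
  using assms(1-5)
proof (induction "card V" arbitrary: V E w rule: less_induct)
  case less
  note fin = less.prems(1) and E = less.prems(2) and w = less.prems(3) and asym = less.prems(4)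
    and no = less.prems(5)
  have finE: "finite E" using fin E by (auto intro: finite_subset)
  show ?case
  proof (cases "\<exists>u\<in>V. \<exists>v\<in>V. u \<noteq> v \<and> \<not> in_common4 E u v")
    case False
    then interpret linked_digraph V "core4 E"
      using E asym by (intro linked_digraph_core4) auto
    have "(x, x) \<notin> core4 E ^^ l" for x
      using no relpow_mono_set[OF core4_subset] by blast
    then obtain A where "A \<subseteq> V" "core4 E \<subseteq> A \<times> (V - A) \<union> (V - A) \<times> A"
      using linked_digraph_bipartite[OF linked_digraph_axioms _ assms(6,7)] by blast
    then have "weight4 (core4 E) w \<le> (sum w V) ^ 4 / 64"
      using fin w asym by (intro weight4_bipartite_le) auto
    then show ?thesis by (simp add: weight4_def closed4_core4)
  next
    case True
    then obtain u v where uv: "u \<in> V" "v \<in> V" "u \<noteq> v" "\<not> in_common4 E u v" by blast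
    \<comment> \<open>Deleting a vertex of weight 0 changes neither side of the bound, and the
      induction hypothesis applies to the rest.\<close>
    have drop: "weight4 E w' \<le> (sum w V) ^ 4 / 64"
      if "x \<in> V" "w' x = 0" "\<And>y. w' y \<ge> 0" "sum w' V = sum w V" for w' x
    proof -
      let ?E = "E \<inter> (- {x}) \<times> (- {x})"
      have "weight4 E w' = weight4 ?E w'" by (rule weight4_remove[of E w' x, OF finE that(2)])
      also have "\<dots> \<le> (sum w' (V - {x})) ^ 4 / 64"
      proof (rule less.hyps)
        show "card (V - {x}) < card V" by (rule card_Diff1_less[OF fin that(1)])
        show "(y, y) \<notin> ?E ^^ l" for y using no[of y] relpow_mono_set[of ?E E l, OF Int_lower1] by (rule contra_subsetD[rotated])
      qed (use fin E that asym in auto)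
      also have "sum w' (V - {x}) = sum w V"
        using that fin by (simp add: sum_diff1)
      finally show ?thesis .
    qed
    let ?s = "w u + w v"
    let ?w1 = "w(u := ?s, v := 0)" and ?w2 = "w(v := ?s, u := 0)"
    have sums: "sum ?w1 V = sum w V" "sum ?w2 V = sum w V"
    proof -
      have V: "V = insert u (insert v (V - {u, v}))" using uv by auto
      have *: "sum f V = f u + f v + sum f (V - {u, v})" for f :: "'a \<Rightarrow> real"
        by (subst V) (use uv fin in simp)
      show "sum ?w1 V = sum w V" "sum ?w2 V = sum w V"
        unfolding * using uv(3) by (auto intro!: sum.cong)
    qed
    have b1: "weight4 E ?w1 \<le> (sum w V) ^ 4 / 64"
      by (rule drop[of v]) (use uv w sums in auto)
    have b2: "weight4 E ?w2 \<le> (sum w V) ^ 4 / 64"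
      by (rule drop[of u]) (use uv w sums in auto)
    show ?thesis
    \<comment> \<open>The convex combination divides by \<open>?s\<close>; if \<open>?s\<close>
      vanishes, \<open>v\<close> has weight 0 already.\<close>
    proof (cases "?s = 0")
      case True
      then have "w v = 0" using w[of u] w[of v] by linarith
      then show ?thesis by (intro drop[of v]) (use uv w in auto)
    next
      case False
      then have s: "?s > 0" using w[of u] w[of v] by linarith
      have "?s * weight4 E w = w u * weight4 E ?w1 + w v * weight4 E ?w2"
        by (rule weight4_shift[OF asym uv(3,4)])
      also have "\<dots> \<le> w u * ((sum w V) ^ 4 / 64) + w v * ((sum w V) ^ 4 / 64)"
        using w b1 b2
        by (intro add_mono mult_left_mono) auto
      also have "\<dots> = ?s * ((sum w V) ^ 4 / 64)" by (simp add: algebra_simps)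
      finally show ?thesis using s by simp
    qed
  qed
qed

section \<open>The density of closed walks\<close>

text \<open>The whole vertex sequence is kept, unlike in \<open>E ^^ l\<close>, so that genuine
  cycles can be told apart from degenerate closed walks by injectivity on
  \<open>{..<l}\<close>.\<close>

definition cyclic_walk :: "'a rel \<Rightarrow> nat \<Rightarrow> (nat \<Rightarrow> 'a) \<Rightarrow> bool" where
  "cyclic_walk E l f \<longleftrightarrow> (\<forall>i<l. (f i, f (Suc i mod l)) \<in> E)"

section \<open>Random maps and redrawing their coordinates\<close>

lemma sum_PiE_insert:
  assumes "i \<notin> J"
  shows "(\<Sum>\<phi>\<in>insert i J \<rightarrow>\<^sub>E V. f \<phi>) = (\<Sum>x\<in>V. \<Sum>g\<in>J \<rightarrow>\<^sub>E V. f (g(i := x)))"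
proof -
  have "(\<Sum>\<phi>\<in>insert i J \<rightarrow>\<^sub>E V. f \<phi>) = (\<Sum>(x, g)\<in>V \<times> (J \<rightarrow>\<^sub>E V). f (g(i := x)))"
    unfolding PiE_insert_eq using inj_combinator[OF assms, of "\<lambda>_. V"]
    by (subst sum.reindex) (auto simp: case_prod_unfold)
  then show ?thesis by (simp add: sum.cartesian_product)
qed

text \<open>A uniformly random map stays uniform when one coordinate is drawn afresh.\<close>

lemma sum_PiE_resample:
  fixes f :: "('i \<Rightarrow> 'a) \<Rightarrow> real"
  assumes "i \<in> I"
  shows "real (card V) * (\<Sum>\<phi>\<in>I \<rightarrow>\<^sub>E V. f \<phi>) = (\<Sum>\<phi>\<in>I \<rightarrow>\<^sub>E V. \<Sum>x\<in>V. f (\<phi>(i := x)))"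
proof -
  define J where "J = I - {i}"
  have I: "I = insert i J" and J: "i \<notin> J" using assms by (auto simp: J_def)
  show ?thesis unfolding I sum_PiE_insert[OF J]
    by (simp add: sum.swap[of _ V])
qed

text \<open>Here \<open>\<psi>\<close> is the pattern of the walk: position \<open>i\<close> shows
  the sampled vertex number \<open>\<psi> i\<close>, so equal values of \<open>\<psi>\<close> impose
  repetitions. Divided by \<open>real (card V) ^ m\<close>, this is the probability that a random
  sample realises the pattern.\<close>

definition walk_count :: "'a set \<Rightarrow> 'a rel \<Rightarrow> nat \<Rightarrow> nat \<Rightarrow> (nat \<Rightarrow> nat) \<Rightarrow> real" where
  "walk_count V E m l \<psi> = (\<Sum>\<phi>\<in>{..<m} \<rightarrow>\<^sub>E V. of_bool (cyclic_walk E l (\<phi> \<circ> \<psi>)))"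

text \<open>Cauchy--Schwarz over the choices for the repeated vertex: two independent choices can be
  given to the two positions.\<close>

lemma walk_count_split:
  assumes fin: "finite V" "V \<noteq> {}" and irr: "\<And>x. (x, x) \<notin> E"
    and ij: "i < l" "j < l" "i \<noteq> j" "\<psi> i = \<psi> j" "\<psi> j < m"
    and t: "t < m" "t \<notin> \<psi> ` {..<l}"
  shows "(walk_count V E m l \<psi>)\<^sup>2 \<le> real (card V) ^ m * walk_count V E m l (\<psi>(j := t))"
proof -
  let ?\<Phi> = "{..<m} \<rightarrow>\<^sub>E V" and ?n = "real (card V)"
  define v where "v = \<psi> j"
  define h where "h \<phi> = (\<Sum>x\<in>V. of_bool (cyclic_walk E l (\<phi>(v := x) \<circ> \<psi>)) :: real)" for \<phi>
  have n: "?n > 0" using fin by (simp add: card_gt_0_iff)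
  have v: "v \<in> {..<m}" "t \<noteq> v" using ij t by (auto simp: v_def)
  have S: "?n * walk_count V E m l \<psi> = (\<Sum>\<phi>\<in>?\<Phi>. h \<phi>)"
    unfolding walk_count_def h_def using v by (intro sum_PiE_resample)
  have S': "?n * (?n * walk_count V E m l (\<psi>(j := t))) =
      (\<Sum>\<phi>\<in>?\<Phi>. \<Sum>x\<in>V. \<Sum>y\<in>V. of_bool (cyclic_walk E l ((\<phi>(v := x))(t := y) \<circ> \<psi>(j := t))))"
    unfolding walk_count_def using v t
    by (subst sum_PiE_resample[of t], simp, subst sum_PiE_resample[of v]) simp_all
  \<comment> \<open>Position \<open>j\<close> receives \<open>y\<close> while the other positions of
    \<open>v\<close> keep \<open>x\<close>. As \<open>E\<close> has no loops, cyclically adjacent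
    positions never both show \<open>v\<close>, so each arc of the new walk already occurs in one of
    the two given walks.\<close>
  have walk: "cyclic_walk E l ((\<phi>(v := x))(t := y) \<circ> \<psi>(j := t))"
    if x: "cyclic_walk E l (\<phi>(v := x) \<circ> \<psi>)" and y: "cyclic_walk E l (\<phi>(v := y) \<circ> \<psi>)" for \<phi> x y
    unfolding cyclic_walk_def
  proof (intro allI impI)
    fix k assume k: "k < l"
    define k' where "k' = Suc k mod l"
    have k': "k' < l" "k' \<noteq> k"
      using k ij by (auto simp: k'_def mod_if split: if_splits)
    have xk: "((\<phi>(v := x)) (\<psi> k), (\<phi>(v := x)) (\<psi> k')) \<in> E"
      and yk: "((\<phi>(v := y)) (\<psi> k), (\<phi>(v := y)) (\<psi> k')) \<in> E"
      using x y k by (auto simp: cyclic_walk_def k'_def)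
    have "\<psi> k \<noteq> t" "\<psi> k' \<noteq> t" using t k k' by auto
    moreover have "\<psi> k \<noteq> \<psi> k'" using xk irr by metis
    ultimately show "(((\<phi>(v := x))(t := y) \<circ> \<psi>(j := t)) k,
        ((\<phi>(v := x))(t := y) \<circ> \<psi>(j := t)) (Suc k mod l)) \<in> E"
      using xk yk k' unfolding k'_def[symmetric] by (auto simp: v_def split: if_splits)
  qed
  have "(?n * walk_count V E m l \<psi>)\<^sup>2 \<le> real (card ?\<Phi>) * (\<Sum>\<phi>\<in>?\<Phi>. (h \<phi>)\<^sup>2)"
    unfolding S using sum_squared_le_sum_of_squares[of h ?\<Phi>] by (simp add: mult.commute)
  also have "\<dots> = ?n ^ m * (\<Sum>\<phi>\<in>?\<Phi>. (h \<phi>)\<^sup>2)" by (simp add: card_PiE)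
  also have "\<dots> \<le> ?n ^ m * (?n * (?n * walk_count V E m l (\<psi>(j := t))))"
    unfolding S' h_def power2_eq_square sum_product
    using walk by (intro mult_left_mono sum_mono) (simp_all del: fun_upd_apply)
  also have "\<dots> = ?n\<^sup>2 * (?n ^ m * walk_count V E m l (\<psi>(j := t)))"
    by (simp only: power2_eq_square mult.assoc mult.left_commute)
  finally show ?thesis using n by (simp only: power_mult_distrib) simp
qed

text \<open>Every realised walk repeats a vertex, and since the pattern does not, two different
  coordinates of the sample collide. A given pair does so with probability
  \<open>1 / card V\<close>, and there are at most \<open>l ^ 2\<close> ordered pairs.\<close>

lemma walk_count_inj:
  assumes fin: "finite V" and noinj: "\<And>f. cyclic_walk E l f \<Longrightarrow> \<not> inj_on f {..<l}"
    and \<psi>: "inj_on \<psi> {..<l}" "\<psi> ` {..<l} \<subseteq> {..<m}"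
  shows "real (card V) * walk_count V E m l \<psi> \<le> real l ^ 2 * real (card V) ^ m"
proof -
  let ?\<Phi> = "{..<m} \<rightarrow>\<^sub>E V" and ?n = "real (card V)"
  define D where "D = {(i, j). i < l \<and> j < l \<and> i \<noteq> j}"
  have D: "finite D" "card D \<le> l ^ 2"
  proof -
    have "D \<subseteq> {..<l} \<times> {..<l}" by (auto simp: D_def)
    then show "finite D" "card D \<le> l ^ 2"
      using card_mono[of "{..<l} \<times> {..<l}" D] by (auto intro: finite_subset simp: power2_eq_square)
  qed
  have coll: "?n * (\<Sum>\<phi>\<in>?\<Phi>. of_bool (\<phi> (\<psi> i) = \<phi> (\<psi> j))) = ?n ^ m" if "(i, j) \<in> D" for i j
  proof -
    have ij: "\<psi> i < m" "\<psi> j < m" "\<psi> i \<noteq> \<psi> j"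
      using that \<psi> by (auto simp: D_def inj_on_def image_subset_iff)
    have "?n * (\<Sum>\<phi>\<in>?\<Phi>. of_bool (\<phi> (\<psi> i) = \<phi> (\<psi> j))) =
        (\<Sum>\<phi>\<in>?\<Phi>. \<Sum>x\<in>V. of_bool (x = \<phi> (\<psi> j)))"
      using ij by (subst sum_PiE_resample[of "\<psi> i"]) auto
    also have "\<dots> = (\<Sum>\<phi>\<in>?\<Phi>. 1)"
    proof (intro sum.cong refl)
      fix \<phi> assume "\<phi> \<in> ?\<Phi>"
      then have "\<phi> (\<psi> j) \<in> V" using ij by auto
      then show "(\<Sum>x\<in>V. of_bool (x = \<phi> (\<psi> j))) = (1::real)"
        using fin by (simp add: of_bool_def)
    qed
    finally show ?thesis by (simp add: card_PiE)
  qed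
  have "walk_count V E m l \<psi> \<le> (\<Sum>\<phi>\<in>?\<Phi>. \<Sum>(i, j)\<in>D. of_bool (\<phi> (\<psi> i) = \<phi> (\<psi> j)))"
    unfolding walk_count_def
  proof (intro sum_mono)
    fix \<phi> assume "\<phi> \<in> ?\<Phi>"
    show "of_bool (cyclic_walk E l (\<phi> \<circ> \<psi>)) \<le> (\<Sum>(i, j)\<in>D. of_bool (\<phi> (\<psi> i) = \<phi> (\<psi> j)) :: real)"
    proof (cases "cyclic_walk E l (\<phi> \<circ> \<psi>)")
      case True
      from noinj[OF this] obtain i j where ij: "(i, j) \<in> D" "\<phi> (\<psi> i) = \<phi> (\<psi> j)"
        by (auto simp: inj_on_def D_def)
      have "(\<Sum>(i, j)\<in>{(i, j)}. of_bool (\<phi> (\<psi> i) = \<phi> (\<psi> j)) :: real)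
          \<le> (\<Sum>(i, j)\<in>D. of_bool (\<phi> (\<psi> i) = \<phi> (\<psi> j)))"
        using ij D by (intro sum_mono2) auto
      then show ?thesis using True ij by simp
    qed (auto intro!: sum_nonneg)
  qed
  also have "\<dots> = (\<Sum>(i, j)\<in>D. \<Sum>\<phi>\<in>?\<Phi>. of_bool (\<phi> (\<psi> i) = \<phi> (\<psi> j)))"
    unfolding case_prod_unfold by (rule sum.swap)
  finally have "?n * walk_count V E m l \<psi> \<le>
      ?n * (\<Sum>(i, j)\<in>D. \<Sum>\<phi>\<in>?\<Phi>. of_bool (\<phi> (\<psi> i) = \<phi> (\<psi> j)))"
    by (intro mult_left_mono) auto
  also have "\<dots> = (\<Sum>(i, j)\<in>D. ?n ^ m)"
    unfolding sum_distrib_left using coll by (intro sum.cong) auto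
  also have "\<dots> = real (card D) * ?n ^ m" by simp
  also have "\<dots> \<le> real l ^ 2 * ?n ^ m"
    using D(2) by (intro mult_right_mono) (auto simp flip: of_nat_power)
  finally show ?thesis .
qed

text \<open>Here \<open>k\<close> counts the values that the pattern lacks for being injective. Each
  split supplies one more value at the price of squaring the density, until
  \<open>walk_count_inj\<close> applies.\<close>

lemma walk_count_power_le:
  assumes fin: "finite V" "V \<noteq> {}" and irr: "\<And>x. (x, x) \<notin> E"
    and noinj: "\<And>f. cyclic_walk E l f \<Longrightarrow> \<not> inj_on f {..<l}"
    and lm: "l \<le> m" and \<psi>: "\<psi> ` {..<l} \<subseteq> {..<m}" and k: "card (\<psi> ` {..<l}) + k = l"
  shows "(walk_count V E m l \<psi> / real (card V) ^ m) ^ (2 ^ k) \<le> real l ^ 2 / real (card V)"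
  using \<psi> k
proof (induction k arbitrary: \<psi>)
  case 0
  have n: "real (card V) > 0" using fin by (simp add: card_gt_0_iff)
  have "inj_on \<psi> {..<l}" using 0 by (intro eq_card_imp_inj_on) auto
  from walk_count_inj[OF fin(1) noinj this 0(1)] show ?case
    using n by (simp add: field_simps)
next
  case (Suc k)
  let ?n = "real (card V)"
  have n: "?n > 0" using fin by (simp add: card_gt_0_iff)
  have "\<not> inj_on \<psi> {..<l}" using Suc.prems card_image[of \<psi> "{..<l}"] by auto
  then obtain i j where ij: "i < l" "j < l" "i \<noteq> j" "\<psi> i = \<psi> j" by (auto simp: inj_on_def)
  \<comment> \<open>A non-injective pattern takes fewer than \<open>l\<close> values, so
    \<open>l \<le> m\<close> leaves a fresh coordinate \<open>t\<close>.\<close>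
  have "card (\<psi> ` {..<l}) < card {..<m}" using Suc.prems lm by simp
  then obtain t where t: "t < m" "t \<notin> \<psi> ` {..<l}"
    using card_mono[of "\<psi> ` {..<l}" "{..<m}"] by fastforce
  define \<psi>' where "\<psi>' = \<psi>(j := t)"
  have im: "\<psi>' ` {..<l} = insert t (\<psi> ` {..<l})"
  proof
    show "\<psi>' ` {..<l} \<subseteq> insert t (\<psi> ` {..<l})" by (auto simp: \<psi>'_def)
    \<comment> \<open>The value overwritten at \<open>j\<close> is still attained at
      \<open>i\<close>.\<close>
    have "\<psi> k \<in> \<psi>' ` {..<l}" if "k < l" for k
      by (rule image_eqI[of _ _ "if k = j then i else k"]) (use ij that in \<open>auto simp: \<psi>'_def\<close>)
    moreover have "t \<in> \<psi>' ` {..<l}" by (rule image_eqI[of _ _ j]) (use ij in \<open>auto simp: \<psi>'_def\<close>)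
    ultimately show "insert t (\<psi> ` {..<l}) \<subseteq> \<psi>' ` {..<l}" by blast
  qed
  have IH: "(walk_count V E m l \<psi>' / ?n ^ m) ^ (2 ^ k) \<le> real l ^ 2 / ?n"
    using Suc.prems t by (intro Suc.IH) (auto simp: im)
  have "(walk_count V E m l \<psi>)\<^sup>2 \<le> ?n ^ m * walk_count V E m l \<psi>'"
    unfolding \<psi>'_def using Suc.prems ij t fin irr by (intro walk_count_split[where i = i]) auto
  then have "(walk_count V E m l \<psi> / ?n ^ m)\<^sup>2 \<le> walk_count V E m l \<psi>' / ?n ^ m"
    using n by (simp add: field_simps power2_eq_square)
  then have "((walk_count V E m l \<psi> / ?n ^ m)\<^sup>2) ^ (2 ^ k) \<le> (walk_count V E m l \<psi>' / ?n ^ m) ^ (2 ^ k)"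
    by (intro power_mono) auto
  with IH show ?case by (simp flip: power_mult)
qed

text \<open>The exponent \<open>2 ^ k\<close> above depends on the pattern; since
  \<open>\<delta> < 1\<close>, passing to \<open>2 ^ l\<close> gives one threshold for all
  patterns.\<close>

lemma walk_count_le:
  assumes fin: "finite V" and irr: "\<And>x. (x, x) \<notin> E"
    and noinj: "\<And>f. cyclic_walk E l f \<Longrightarrow> \<not> inj_on f {..<l}"
    and lm: "l \<le> m" and \<psi>: "\<psi> ` {..<l} \<subseteq> {..<m}"
    and \<delta>: "0 < \<delta>" "\<delta> < 1" and n: "real (card V) > real l ^ 2 / \<delta> ^ (2 ^ l)"
  shows "walk_count V E m l \<psi> \<le> \<delta> * real (card V) ^ m"
proof (rule ccontr)
  let ?n = "real (card V)" 
  assume neg: "\<not> ?thesis"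
  have n0: "?n > 0" using n \<delta> by (smt (verit) divide_nonneg_nonneg of_nat_0_le_iff zero_le_power)
  define k where "k = l - card (\<psi> ` {..<l})"
  have k: "card (\<psi> ` {..<l}) + k = l"
    using card_image_le[of "{..<l}" \<psi>] by (simp add: k_def)
  have "\<delta> < walk_count V E m l \<psi> / ?n ^ m" using neg n0 by (simp add: field_simps)
  then have "\<delta> ^ (2 ^ k) \<le> (walk_count V E m l \<psi> / ?n ^ m) ^ (2 ^ k)"
    using \<delta> by (intro power_mono) auto
  also have "\<dots> \<le> real l ^ 2 / ?n"
    using n0 by (intro walk_count_power_le[OF fin _ irr noinj lm \<psi> k]) auto
  finally have "\<delta> ^ (2 ^ k) \<le> real l ^ 2 / ?n" .
  moreover have "\<delta> ^ (2 ^ l) \<le> \<delta> ^ (2 ^ k)"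
    using \<delta> k by (intro power_decreasing power_increasing) auto
  ultimately have "\<delta> ^ (2 ^ l) \<le> real l ^ 2 / ?n" by simp
  then show False using n n0 \<delta> by (simp add: field_simps)
qed

text \<open>Redrawing the four coordinates one after another shows that they are independent and
  uniform.\<close>

lemma card_PiE_four:
  fixes V :: "'a set"
  assumes fin: "finite V" and d: "a \<noteq> b" "a \<noteq> c" "a \<noteq> d" "b \<noteq> c" "b \<noteq> d" "c \<noteq> d"
    and m: "a < m" "b < m" "c < m" "d < m" and Q: "Q \<subseteq> V \<times> V \<times> V \<times> V"
  shows "real (card V) ^ 4 * (\<Sum>\<phi>\<in>{..<m::nat} \<rightarrow>\<^sub>E V. of_bool ((\<phi> a, \<phi> b, \<phi> c, \<phi> d) \<in> Q)) =
    real (card V) ^ m * real (card Q)"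
proof -
  let ?\<Phi> = "{..<m} \<rightarrow>\<^sub>E V" and ?n = "real (card V)"
  have "?n ^ 4 * (\<Sum>\<phi>\<in>?\<Phi>. of_bool ((\<phi> a, \<phi> b, \<phi> c, \<phi> d) \<in> Q)) =
      ?n * (?n * (?n * (?n * (\<Sum>\<phi>\<in>?\<Phi>. of_bool ((\<phi> a, \<phi> b, \<phi> c, \<phi> d) \<in> Q)))))"
    by (simp add: power4_eq_xxxx)
  also have "\<dots> = (\<Sum>\<phi>\<in>?\<Phi>. \<Sum>w\<in>V. \<Sum>x\<in>V. \<Sum>y\<in>V. \<Sum>z\<in>V. of_bool ((w, x, y, z) \<in> Q))"
  proof -
    have "?n * (\<Sum>\<phi>\<in>?\<Phi>. of_bool ((\<phi> a, \<phi> b, \<phi> c, \<phi> d) \<in> Q)) =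
        (\<Sum>\<phi>\<in>?\<Phi>. \<Sum>z\<in>V. of_bool ((\<phi> a, \<phi> b, \<phi> c, z) \<in> Q))"
      using m d by (subst sum_PiE_resample[of d]) auto
    moreover have "?n * (\<Sum>\<phi>\<in>?\<Phi>. \<Sum>z\<in>V. of_bool ((\<phi> a, \<phi> b, \<phi> c, z) \<in> Q)) =
        (\<Sum>\<phi>\<in>?\<Phi>. \<Sum>y\<in>V. \<Sum>z\<in>V. of_bool ((\<phi> a, \<phi> b, y, z) \<in> Q))"
      using m d by (subst sum_PiE_resample[of c]) auto
    moreover have "?n * (\<Sum>\<phi>\<in>?\<Phi>. \<Sum>y\<in>V. \<Sum>z\<in>V. of_bool ((\<phi> a, \<phi> b, y, z) \<in> Q)) =
        (\<Sum>\<phi>\<in>?\<Phi>. \<Sum>x\<in>V. \<Sum>y\<in>V. \<Sum>z\<in>V. of_bool ((\<phi> a, x, y, z) \<in> Q))"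
      using m d by (subst sum_PiE_resample[of b]) auto
    moreover have "?n * (\<Sum>\<phi>\<in>?\<Phi>. \<Sum>x\<in>V. \<Sum>y\<in>V. \<Sum>z\<in>V. of_bool ((\<phi> a, x, y, z) \<in> Q)) =
        (\<Sum>\<phi>\<in>?\<Phi>. \<Sum>w\<in>V. \<Sum>x\<in>V. \<Sum>y\<in>V. \<Sum>z\<in>V. of_bool ((w, x, y, z) \<in> Q))"
      using m d by (subst sum_PiE_resample[of a]) auto
    ultimately show ?thesis by (simp only:)
  qed
  also have "(\<Sum>w\<in>V. \<Sum>x\<in>V. \<Sum>y\<in>V. \<Sum>z\<in>V. of_bool ((w, x, y, z) \<in> Q)) = real (card Q)"
  proof -
    have "(\<Sum>w\<in>V. \<Sum>x\<in>V. \<Sum>y\<in>V. \<Sum>z\<in>V. of_bool ((w, x, y, z) \<in> Q)) =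
        (\<Sum>q\<in>V \<times> V \<times> V \<times> V. of_bool (q \<in> Q) :: real)"
      by (simp add: sum.cartesian_product case_prod_unfold)
    also have "\<dots> = (\<Sum>q\<in>Q. 1)"
      using Q fin by (intro sum.mono_neutral_cong_right) auto
    finally show ?thesis by simp
  qed
  finally show ?thesis by (simp add: card_PiE)
qed

section \<open>Sampling\<close>

lemma closed4_subset_times: "E \<subseteq> V \<times> V \<Longrightarrow> closed4 E \<subseteq> V \<times> V \<times> V \<times> V"
  by (auto simp: closed4_def)

lemma card_closed4_le:
  assumes "E \<subseteq> V \<times> V" "finite V"
  shows "card (closed4 E) \<le> card V ^ 4"
proof -
  have "card (closed4 E) \<le> card (V \<times> V \<times> V \<times> V)"
    using assms closed4_subset_times by (intro card_mono) auto
  then show ?thesis by (simp add: card_cartesian_product power4_eq_xxxx mult.assoc)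
qed

definition distinct4 :: "nat \<Rightarrow> (nat \<times> nat \<times> nat \<times> nat) set" where
  "distinct4 m = (SIGMA a:{..<m}. SIGMA b:{..<m} - {a}. SIGMA c:{..<m} - {a, b}. {..<m} - {a, b, c})"

text \<open>Each position has at most three earlier ones to avoid; the common bound
  \<open>m - 3\<close> keeps the estimate a fourth power.\<close>

lemma card_distinct4_ge: "(m - 3) ^ 4 \<le> card (distinct4 m)"
proof -
  have sig: "x * y \<le> card (Sigma A B)"
    if "x \<le> card A" "finite A" "\<And>a. a \<in> A \<Longrightarrow> finite (B a) \<and> y \<le> card (B a)"
    for x y :: nat and A :: "nat set" and B :: "nat \<Rightarrow> 'b set"
  proof -
    have "x * y \<le> (\<Sum>a\<in>A. y)" using that by simp
    also have "\<dots> \<le> (\<Sum>a\<in>A. card (B a))" using that by (intro sum_mono) auto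
    finally show ?thesis using that by simp
  qed
  have diff: "m - 3 \<le> card ({..<m} - set xs)" if "length xs \<le> 3" for xs
  proof -
    have "card {..<m} - card (set xs) \<le> card ({..<m} - set xs)" by (rule diff_card_le_card_Diff) simp
    moreover have "card (set xs) \<le> 3" using card_length[of xs] that by linarith
    ultimately show ?thesis by simp
  qed
  have "(m - 3) * ((m - 3) * ((m - 3) * (m - 3))) \<le> card (distinct4 m)"
    unfolding distinct4_def
    using diff[of "[]"] diff[of "[_]"] diff[of "[_, _]"] diff[of "[_, _, _]"]
    by (intro sig conjI) auto
  then show ?thesis by (simp add: power4_eq_xxxx mult.assoc)
qed

text \<open>Double counting of samples \<open>\<phi>\<close> together with four distinct positions
  carrying a closed 4-walk. Each quadruple of positions succeeds with the density of
  \<open>closed4 E\<close>. Conversely, a sample without closed \<open>l\<close>-walks obeys the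
  weighted bound, and any other is bounded trivially by \<open>m ^ 4\<close> and charged to a
  pattern it realises; there are \<open>m ^ l\<close> patterns.\<close>

lemma closed4_sampling:
  assumes fin: "finite V" "V \<noteq> {}" and E: "E \<subseteq> V \<times> V" and asym: "\<And>u v. (u, v) \<in> E \<Longrightarrow> (v, u) \<notin> E"
    and l: "l > 4" "\<not> 4 dvd l" and \<gamma>: "\<And>\<psi>. \<psi> \<in> {..<l} \<rightarrow>\<^sub>E {..<m} \<Longrightarrow> walk_count V E m l \<psi> \<le> \<gamma> * real (card V) ^ m"
  shows "real (card (closed4 E)) * real (m - 3) ^ 4 \<le>
     real (card V) ^ 4 * (real m ^ 4 * (1 / 64 + real m ^ l * \<gamma>))"
proof -
  let ?\<Phi> = "{..<m} \<rightarrow>\<^sub>E V" and ?n = "real (card V)" and ?\<Psi> = "{..<l} \<rightarrow>\<^sub>E {..<m}"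
  \<comment> \<open>The sampled digraph lives on the indices, so a vertex drawn several times is
    simply duplicated and each index gets weight 1.\<close>
  define pull where "pull \<phi> = {(i, j). i < m \<and> j < m \<and> (\<phi> i, \<phi> j) \<in> E}" for \<phi> :: "nat \<Rightarrow> 'a"
  have n: "?n > 0" using fin by (simp add: card_gt_0_iff)
  have pull_sub: "pull \<phi> \<subseteq> {..<m} \<times> {..<m}" for \<phi> by (auto simp: pull_def)
  have upper: "real (card (closed4 (pull \<phi>))) \<le>
      real m ^ 4 / 64 + real m ^ 4 * (\<Sum>\<psi>\<in>?\<Psi>. of_bool (cyclic_walk E l (\<phi> \<circ> \<psi>)))" for \<phi>
  proof (cases "\<exists>x. (x, x) \<in> pull \<phi> ^^ l")
    case False
    then have "weight4 (pull \<phi>) (\<lambda>_. 1) \<le> (sum (\<lambda>_. 1) {..<m}) ^ 4 / 64"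
      using pull_sub asym l by (intro weight4_le) (auto simp: pull_def)
    then have "real (card (closed4 (pull \<phi>))) \<le> real m ^ 4 / 64"
      by (simp add: weight4_def case_prod_unfold)
    moreover have "0 \<le> real m ^ 4 * (\<Sum>\<psi>\<in>?\<Psi>. of_bool (cyclic_walk E l (\<phi> \<circ> \<psi>)))"
      by (intro mult_nonneg_nonneg sum_nonneg) auto
    ultimately show ?thesis by linarith
  next
    case True
    then obtain x f where f: "f 0 = x" "f l = x" "\<And>i. i < l \<Longrightarrow> (f i, f (Suc i)) \<in> pull \<phi>"
      by (auto simp: relpow_fun_conv)
    define \<psi> where "\<psi> = restrict f {..<l}"
    have \<psi>: "\<psi> \<in> ?\<Psi>" using f(3) by (auto simp: \<psi>_def pull_def)
    have "cyclic_walk E l (\<phi> \<circ> \<psi>)"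
      unfolding cyclic_walk_def
    proof (intro allI impI)
      fix i assume i: "i < l"
      have "\<psi> (Suc i mod l) = f (Suc i)"
        using i f(1,2) l by (cases "Suc i = l") (auto simp: \<psi>_def)
      then show "((\<phi> \<circ> \<psi>) i, (\<phi> \<circ> \<psi>) (Suc i mod l)) \<in> E"
        using f(3)[OF i] i by (auto simp: \<psi>_def pull_def)
    qed
    then have "1 \<le> (\<Sum>\<psi>\<in>{\<psi>}. of_bool (cyclic_walk E l (\<phi> \<circ> \<psi>)) :: real)" by simp
    also have "\<dots> \<le> (\<Sum>\<psi>\<in>?\<Psi>. of_bool (cyclic_walk E l (\<phi> \<circ> \<psi>)))"
      using \<psi> by (intro sum_mono2 finite_PiE) auto
    finally have "real m ^ 4 * 1 \<le> real m ^ 4 * (\<Sum>\<psi>\<in>?\<Psi>. of_bool (cyclic_walk E l (\<phi> \<circ> \<psi>)))"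
      by (intro mult_left_mono) auto
    moreover have "real (card (closed4 (pull \<phi>))) \<le> real m ^ 4"
      using card_closed4_le[OF pull_sub, of \<phi>] by (simp flip: of_nat_power)
    moreover have "0 \<le> real m ^ 4 / 64" by simp
    ultimately show ?thesis by linarith
  qed
  have lower: "(\<Sum>q\<in>distinct4 m. of_bool (q \<in> closed4 (pull \<phi>))) \<le> real (card (closed4 (pull \<phi>)))" for \<phi>
  proof -
    have "finite (distinct4 m)" by (auto simp: distinct4_def)
    then have "(\<Sum>q\<in>distinct4 m. of_bool (q \<in> closed4 (pull \<phi>)) :: real) = real (card (distinct4 m \<inter> closed4 (pull \<phi>)))"
      by (simp add: of_bool_def sum.If_cases Int_def)
    also have "\<dots> \<le> real (card (closed4 (pull \<phi>)))"
      using pull_sub[of \<phi>] by (intro of_nat_mono card_mono finite_closed4) (auto intro: finite_subset)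
    finally show ?thesis .
  qed
  have quad: "?n ^ 4 * (\<Sum>\<phi>\<in>?\<Phi>. of_bool (q \<in> closed4 (pull \<phi>))) = ?n ^ m * real (card (closed4 E))"
    if "q \<in> distinct4 m" for q
  proof -
    obtain a b c d where q: "q = (a, b, c, d)" by (cases q)
    have abcd: "a \<noteq> b" "a \<noteq> c" "a \<noteq> d" "b \<noteq> c" "b \<noteq> d" "c \<noteq> d" "a < m" "b < m" "c < m" "d < m"
      using that by (auto simp: q distinct4_def)
    have "q \<in> closed4 (pull \<phi>) \<longleftrightarrow> (\<phi> a, \<phi> b, \<phi> c, \<phi> d) \<in> closed4 E" for \<phi>
      using abcd by (simp add: q closed4_def pull_def)
    then show ?thesis
      using card_PiE_four[OF fin(1) abcd closed4_subset_times[OF E]] by simp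
  qed
  have "?n ^ m * (real (card (closed4 E)) * real (card (distinct4 m))) =
      (\<Sum>q\<in>distinct4 m. ?n ^ 4 * (\<Sum>\<phi>\<in>?\<Phi>. of_bool (q \<in> closed4 (pull \<phi>))))"
    by (simp add: quad)
  also have "\<dots> = ?n ^ 4 * (\<Sum>\<phi>\<in>?\<Phi>. \<Sum>q\<in>distinct4 m. of_bool (q \<in> closed4 (pull \<phi>)))"
    unfolding sum_distrib_left[symmetric] by (subst sum.swap) simp
  also have "\<dots> \<le> ?n ^ 4 * (\<Sum>\<phi>\<in>?\<Phi>. real m ^ 4 / 64 +
      real m ^ 4 * (\<Sum>\<psi>\<in>?\<Psi>. of_bool (cyclic_walk E l (\<phi> \<circ> \<psi>))))"
    by (intro mult_left_mono sum_mono order_trans[OF lower upper]) auto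
  also have "\<dots> = ?n ^ 4 * (?n ^ m * (real m ^ 4 / 64) + real m ^ 4 * (\<Sum>\<psi>\<in>?\<Psi>. walk_count V E m l \<psi>))"
    unfolding sum.distrib sum_distrib_left[symmetric] walk_count_def
    by (subst (2) sum.swap) (simp add: card_PiE)
  also have "\<dots> \<le> ?n ^ 4 * (?n ^ m * (real m ^ 4 / 64) + real m ^ 4 * (\<Sum>\<psi>\<in>?\<Psi>. \<gamma> * ?n ^ m))"
    using \<gamma> by (intro mult_left_mono add_left_mono sum_mono) auto
  also have "\<dots> = ?n ^ m * (?n ^ 4 * (real m ^ 4 * (1 / 64 + real m ^ l * \<gamma>)))"
    by (simp add: card_PiE algebra_simps)
  finally have "real (card (closed4 E)) * real (card (distinct4 m)) \<le>
      ?n ^ 4 * (real m ^ 4 * (1 / 64 + real m ^ l * \<gamma>))"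
    using n by simp
  moreover have "real (card (closed4 E)) * real (m - 3) ^ 4 \<le> real (card (closed4 E)) * real (card (distinct4 m))"
    using card_distinct4_ge[of m] by (intro mult_left_mono) (auto simp flip: of_nat_power)
  ultimately show ?thesis by linarith
qed

text \<open>The order of choices matters: \<open>m\<close> is fixed first, so that restricting to
  distinct positions costs little, then \<open>\<gamma>\<close> so small that even
  \<open>m ^ l\<close> patterns contribute at most \<open>\<epsilon> / 2\<close>, and only then the
  threshold on \<open>card V\<close>.\<close>

lemma card_closed4_asymptotic:
  assumes l: "l > 4" "\<not> 4 dvd l" and \<epsilon>: "\<epsilon> > (0::real)"
  obtains n0 where "\<And>V (E :: 'a rel). finite V \<Longrightarrow> E \<subseteq> V \<times> V \<Longrightarrow> (\<And>u v. (u, v) \<in> E \<Longrightarrow> (v, u) \<notin> E) \<Longrightarrow>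
     (\<And>f. cyclic_walk E l f \<Longrightarrow> \<not> inj_on f {..<l}) \<Longrightarrow> card V \<ge> n0 \<Longrightarrow>
     real (card (closed4 E)) \<le> (1 / 64 + \<epsilon>) * real (card V) ^ 4"
proof -
  \<comment> \<open>By Bernoulli, \<open>(1 - 3 / m) ^ 4\<close> is at least
    \<open>1 - 12 / m\<close>; this choice makes \<open>12 / m * (1 / 64 + \<epsilon>)\<close> at
    most \<open>\<epsilon> / 2\<close>.\<close>
  obtain m0 :: nat where m0: "real m0 \<ge> 24 * (1 / 64 + \<epsilon>) / \<epsilon>" using real_arch_simple by blast
  define m where "m = max (max m0 l) 4"
  have m: "m \<ge> 4" "m \<ge> l" "real m \<ge> 24 * (1 / 64 + \<epsilon>) / \<epsilon>" using m0 by (auto simp: m_def)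
  define \<gamma> where "\<gamma> = min (1 / 2) (\<epsilon> / (2 * real m ^ l))"
  have \<gamma>: "0 < \<gamma>" "\<gamma> < 1" "real m ^ l * \<gamma> \<le> \<epsilon> / 2"
  proof -
    show "0 < \<gamma>" "\<gamma> < 1" using \<epsilon> m by (auto simp: \<gamma>_def)
    have "real m ^ l * \<gamma> \<le> real m ^ l * (\<epsilon> / (2 * real m ^ l))" by (intro mult_left_mono) (auto simp: \<gamma>_def)
    then show "real m ^ l * \<gamma> \<le> \<epsilon> / 2" using m by simp
  qed
  have m3: "real m ^ 4 * (1 / 64 + \<epsilon> / 2) \<le> (1 / 64 + \<epsilon>) * real (m - 3) ^ 4"
  proof -
    have "1 / 64 + \<epsilon> / 2 \<le> (1 / 64 + \<epsilon>) * (1 - 12 / real m)"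
      using m \<epsilon> by (simp add: field_simps)
    also have "1 - 12 / real m \<le> (1 - 3 / real m) ^ 4"
      using Bernoulli_inequality[of "- (3 / real m)" 4] m by (simp add: field_simps)
    finally have "1 / 64 + \<epsilon> / 2 \<le> (1 / 64 + \<epsilon>) * (1 - 3 / real m) ^ 4"
      using \<epsilon> by (simp add: mult_left_mono)
    then have "real m ^ 4 * (1 / 64 + \<epsilon> / 2) \<le> (1 / 64 + \<epsilon>) * (real m ^ 4 * (1 - 3 / real m) ^ 4)"
      by (simp add: mult_left_mono mult.left_commute)
    also have "real m ^ 4 * (1 - 3 / real m) ^ 4 = real (m - 3) ^ 4"
      using m by (simp add: field_simps flip: power_mult_distrib)
    finally show ?thesis .
  qed
  obtain n0 :: nat where n0: "real n0 > real l ^ 2 / \<gamma> ^ (2 ^ l)" using reals_Archimedean2 by blast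
  show ?thesis
  proof (rule that[of "max n0 1"])
    fix V and E :: "'a rel"
    assume fin: "finite V" and E: "E \<subseteq> V \<times> V" and asym: "\<And>u v. (u, v) \<in> E \<Longrightarrow> (v, u) \<notin> E"
      and noinj: "\<And>f. cyclic_walk E l f \<Longrightarrow> \<not> inj_on f {..<l}" and n: "max n0 1 \<le> card V"
    let ?n = "real (card V)"
    have "walk_count V E m l \<psi> \<le> \<gamma> * ?n ^ m" if "\<psi> \<in> {..<l} \<rightarrow>\<^sub>E {..<m}" for \<psi>
      using n n0 by (intro walk_count_le[OF fin _ noinj m(2) _ \<gamma>(1,2)]) (use asym that in auto)
    then have "real (card (closed4 E)) * real (m - 3) ^ 4 \<le> ?n ^ 4 * (real m ^ 4 * (1 / 64 + real m ^ l * \<gamma>))"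
      using n by (intro closed4_sampling fin E asym l) auto
    also have "\<dots> \<le> ?n ^ 4 * (real m ^ 4 * (1 / 64 + \<epsilon> / 2))"
      using \<gamma>(3) by (intro mult_left_mono) auto
    also have "\<dots> \<le> ?n ^ 4 * ((1 / 64 + \<epsilon>) * real (m - 3) ^ 4)"
      using m3 by (intro mult_left_mono) auto
    also have "\<dots> = ((1 / 64 + \<epsilon>) * ?n ^ 4) * real (m - 3) ^ 4" by (simp only: mult_ac)
    finally show "real (card (closed4 E)) \<le> (1 / 64 + \<epsilon>) * ?n ^ 4"
      by (rule mult_right_le_imp_le) (use m(1) in simp)
  qed
qed

section \<open>Copies of directed cycles\<close>

definition cycle_image :: "nat \<Rightarrow> (nat \<Rightarrow> 'a) \<Rightarrow> 'a pair_pre_digraph" where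
  "cycle_image m f = \<lparr> pverts = f ` {..<m}, parcs = (\<lambda>i. (f i, f (Suc i mod m))) ` {..<m} \<rparr>"

text \<open>Replaces isomorphism by explicit vertex sequences, both for counting 4-cycles and for
  excluding \<open>l\<close>-cycles. The sequence \<open>f\<close> is not unique: its rotations give
  the same copy.\<close>

lemma mem_copies_dicycle_iff:
  assumes wf: "pair_wf_digraph G" and m: "m > 0"
  shows "C \<in> copies (dicycle m) G \<longleftrightarrow>
     (\<exists>f. inj_on f {..<m} \<and> cyclic_walk (parcs G) m f \<and> C = cycle_image m f)"
proof
  assume C: "C \<in> copies (dicycle m) G"
  then obtain g where g: "pre_digraph.digraph_isomorphism (with_proj (dicycle m)) g"
    and Cg: "with_proj C = app_iso g (with_proj (dicycle m))"
    by (auto simp: copies_def digraph_iso_def)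
  \<comment> \<open>Isomorphisms carry their own tail and head maps. As both graphs come from
    \<open>with_proj\<close>, these are the projections, and so the vertex map determines the arc
    map.\<close>
  have th: "iso_tail g = fst" "iso_head g = snd"
    using Cg by (metis tail_app_iso with_proj_simps(4)) (use Cg in \<open>metis head_app_iso with_proj_simps(5)\<close>)
  have inj: "inj_on (iso_verts g) {..<m}"
    using g by (simp add: pre_digraph.digraph_isomorphism_def dicycle_def)
  have arcs: "iso_arcs g a = (iso_verts g (fst a), iso_verts g (snd a))" if "a \<in> parcs (dicycle m)" for a
    using g that th by (auto simp: pre_digraph.digraph_isomorphism_def prod_eq_iff)
  have "pverts C = iso_verts g ` {..<m}"
    using Cg by (metis verts_app_iso with_proj_simps(1) dicycle_def pair_pre_digraph.select_convs(1))
  moreover have "parcs C = iso_arcs g ` parcs (dicycle m)"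
    using Cg by (metis arcs_app_iso with_proj_simps(2))
  then have "parcs C = (\<lambda>i. (iso_verts g i, iso_verts g (Suc i mod m))) ` {..<m}"
    using arcs by (simp add: dicycle_def image_image)
  ultimately have Ceq: "C = cycle_image m (iso_verts g)" by (simp add: cycle_image_def)
  have "parcs C \<subseteq> parcs G" using C by (auto simp: copies_def subgraph_def)
  then have "cyclic_walk (parcs G) m (iso_verts g)"
    unfolding Ceq by (auto simp: cyclic_walk_def cycle_image_def)
  with inj Ceq show "\<exists>f. inj_on f {..<m} \<and> cyclic_walk (parcs G) m f \<and> C = cycle_image m f" by blast
next
  assume "\<exists>f. inj_on f {..<m} \<and> cyclic_walk (parcs G) m f \<and> C = cycle_image m f"
  then obtain f where inj: "inj_on f {..<m}" and walk: "cyclic_walk (parcs G) m f"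
    and C: "C = cycle_image m f" by blast
  have wfC: "pair_wf_digraph C" using m by unfold_locales (auto simp: C cycle_image_def)
  have wfD: "pair_wf_digraph (dicycle m)" using m by unfold_locales (auto simp: dicycle_def)
  have sub: "subgraph (with_proj C) (with_proj G)"
    unfolding subgraph_def compatible_def wf_digraph_wp_iff
    using wf wfC walk pair_wf_digraph.arc_fst_in_verts[OF wf]
    by (fastforce simp: C cycle_image_def cyclic_walk_def)
  define g where "g = \<lparr> iso_verts = f, iso_arcs = map_prod f f, iso_head = snd, iso_tail = fst \<rparr>"
  have "parcs (dicycle m) \<subseteq> {..<m} \<times> {..<m}" using m by (auto simp: dicycle_def)
  then have "inj_on (map_prod f f) (parcs (dicycle m))"
    using inj by (auto intro: inj_on_subset[OF map_prod_inj_on])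
  then have "pre_digraph.digraph_isomorphism (with_proj (dicycle m)) g"
    using wfD inj unfolding pre_digraph.digraph_isomorphism_def wf_digraph_wp_iff
    by (auto simp: g_def dicycle_def)
  moreover have "with_proj C = app_iso g (with_proj (dicycle m))"
    by (simp add: with_proj_def app_iso_def g_def C cycle_image_def dicycle_def image_image)
  ultimately have "digraph_iso (with_proj (dicycle m)) (with_proj C)"
    unfolding digraph_iso_def by blast
  with sub show "C \<in> copies (dicycle m) G" by (simp add: copies_def)
qed

lemma oriented_graphD:
  assumes "oriented_graph G"
  shows "pair_wf_digraph G" "finite (pverts G)" "parcs G \<subseteq> pverts G \<times> pverts G"
    "\<And>u v. (u, v) \<in> parcs G \<Longrightarrow> (v, u) \<notin> parcs G"
proof -
  interpret pair_digraph G using assms by (simp add: oriented_graph_def)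
  show "pair_wf_digraph G" by unfold_locales
  show "finite (pverts G)" by simp
  show "parcs G \<subseteq> pverts G \<times> pverts G" using arc_fst_in_verts arc_snd_in_verts by fastforce
  show "\<And>u v. (u, v) \<in> parcs G \<Longrightarrow> (v, u) \<notin> parcs G" using assms by (simp add: oriented_graph_def)
qed

text \<open>Each copy is sent to the four rotations of a chosen vertex sequence. This is injective:
  \<open>gr\<close> recovers the copy from any rotation, and the first entry then determines the
  rotation.\<close>

lemma card_copies_dicycle_4:
  assumes G: "oriented_graph G"
  shows "4 * card (copies (dicycle 4) G) \<le> card (closed4 (parcs G))"
proof -
  note G' = oriented_graphD[OF G]
  have fin: "finite (closed4 (parcs G))"
    using G'(2,3) by (intro finite_closed4) (auto intro: finite_subset)
  have "\<forall>C\<in>copies (dicycle 4) G. \<exists>f. inj_on f {..<4} \<and> cyclic_walk (parcs G) 4 f \<and> C = cycle_image 4 f"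
    using mem_copies_dicycle_iff[OF G'(1), of 4] by simp
  from bchoice[OF this] obtain F where F: "\<And>C. C \<in> copies (dicycle 4) G \<Longrightarrow>
      inj_on (F C) {..<4} \<and> cyclic_walk (parcs G) 4 (F C) \<and> C = cycle_image 4 (F C)" by blast
  define rot where "rot = (\<lambda>(C, k). let s = (\<lambda>i. Suc i mod 4) in (F C k, F C (s k), F C (s (s k)), F C (s (s (s k)))))"
  define gr :: "'a \<times> 'a \<times> 'a \<times> 'a \<Rightarrow> 'a pair_pre_digraph"
    where "gr = (\<lambda>(a, b, c, d). \<lparr> pverts = {a, b, c, d}, parcs = {(a, b), (b, c), (c, d), (d, a)} \<rparr>)"
  have four: "{..<4} = {0, 1, 2, 3 :: nat}" by auto
  have mods: "Suc 0 mod 4 = (1::nat)" "Suc 1 mod 4 = (2::nat)" "Suc 2 mod 4 = (3::nat)" "Suc 3 mod 4 = (0::nat)"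
    by auto
  have k4: "k = 0 \<or> k = 1 \<or> k = 2 \<or> k = 3" if "k < 4" for k :: nat using that by auto
  have gr: "gr (rot (C, k)) = C" if "C \<in> copies (dicycle 4) G" "k < 4" for C k
  proof -
    have "gr (rot (C, k)) = cycle_image 4 (F C)"
      using k4[OF that(2)]
      by (elim disjE; simp only: gr_def rot_def cycle_image_def four mods Let_def prod.case
          image_insert image_empty) (simp_all add: insert_commute)
    then show ?thesis using F[OF that(1)] by simp
  qed
  have "inj_on rot (copies (dicycle 4) G \<times> {..<4})"
  proof (rule inj_onI, clarsimp)
    fix C k C' k'
    assume C: "C \<in> copies (dicycle 4) G" "C' \<in> copies (dicycle 4) G" and k: "k < 4" "k' < (4::nat)"
      and eq: "rot (C, k) = rot (C', k')"
    have "C = C'" using gr[OF C(1) k(1)] gr[OF C(2) k(2)] eq by simp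
    moreover from this have "F C k = F C k'" using eq by (simp add: rot_def)
    then have "k = k'" using F[OF C(1)] k by (auto dest: inj_onD)
    ultimately show "C = C' \<and> k = k'" by simp
  qed
  moreover have "rot ` (copies (dicycle 4) G \<times> {..<4}) \<subseteq> closed4 (parcs G)"
  proof clarsimp
    fix C k assume C: "C \<in> copies (dicycle 4) G" and k: "k < (4::nat)"
    have "cyclic_walk (parcs G) 4 (F C)" using F[OF C] by blast
    then have w: "(F C i, F C (Suc i mod 4)) \<in> parcs G" if "i < 4" for i
      using that by (simp add: cyclic_walk_def)
    have "(F C 0, F C 1) \<in> parcs G" "(F C 1, F C 2) \<in> parcs G"
      "(F C 2, F C 3) \<in> parcs G" "(F C 3, F C 0) \<in> parcs G"
      using w[of 0, unfolded mods] w[of 1, unfolded mods] w[of 2, unfolded mods] w[of 3, unfolded mods]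
      by simp_all
    then show "rot (C, k) \<in> closed4 (parcs G)"
      using k4[OF k] by (elim disjE; simp only: rot_def closed4_def mods Let_def prod.case mem_Collect_eq)
  qed
  ultimately have "card (copies (dicycle 4) G \<times> {..<4::nat}) \<le> card (closed4 (parcs G))"
    using card_inj_on_le fin by blast
  then show ?thesis by (simp add: card_cartesian_product mult.commute)
qed

section \<open>Lower bound: the blow-up of the directed 4-cycle, with the residue classes modulo 4
  as parts\<close>

definition blowup4 :: "nat \<Rightarrow> nat pair_pre_digraph" where
  "blowup4 n = \<lparr> pverts = {..<n}, parcs = {(i, j). i < n \<and> j < n \<and> j mod 4 = Suc i mod 4} \<rparr>"

lemma oriented_blowup4: "oriented_graph (blowup4 n)"
proof -
  have no_loop: "i mod 4 \<noteq> Suc i mod 4" for i :: nat by presburger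
  have "i mod 4 \<noteq> Suc (Suc i) mod 4" for i :: nat by presburger
  then have asym: "i mod 4 \<noteq> Suc j mod 4" if "j mod 4 = Suc i mod 4" for i j :: nat
    using that by (metis mod_Suc_eq)
  have "pair_digraph (blowup4 n)"
  proof
    show "finite (parcs (blowup4 n))"
      by (rule finite_subset[of _ "{..<n} \<times> {..<n}"]) (auto simp: blowup4_def)
    show "fst e \<noteq> snd e" if "e \<in> parcs (blowup4 n)" for e
      using that no_loop by (auto simp: blowup4_def)
  qed (auto simp: blowup4_def)
  moreover have "(v, u) \<notin> parcs (blowup4 n)" if "(u, v) \<in> parcs (blowup4 n)" for u v
    using that asym by (simp add: blowup4_def)
  ultimately show ?thesis by (simp add: oriented_graph_def)
qed

text \<open>The residue modulo 4 grows by one along each arc, so returning to the start after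
  \<open>l\<close> steps forces 4 to divide \<open>l\<close>.\<close>

lemma copies_dicycle_blowup4:
  assumes "l > 0" "\<not> 4 dvd l"
  shows "copies (dicycle l) (blowup4 n) = {}"
proof (rule ccontr)
  assume "copies (dicycle l) (blowup4 n) \<noteq> {}"
  then obtain f where walk: "cyclic_walk (parcs (blowup4 n)) l f"
    using mem_copies_dicycle_iff[OF oriented_graphD(1)[OF oriented_blowup4] assms(1)] by blast
  have step: "f (Suc i mod l) mod 4 = Suc (f i) mod 4" if "i < l" for i
    using walk that by (auto simp: cyclic_walk_def blowup4_def)
  have "f i mod 4 = (f 0 + i) mod 4" if "i < l" for i
    using that
  proof (induction i)
    case (Suc i)
    then have "f (Suc i) mod 4 = Suc (f i) mod 4" using step[of i] by simp
    also have "\<dots> = Suc (f i mod 4) mod 4" by (simp add: mod_Suc_eq)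
    also have "\<dots> = Suc (f 0 + i) mod 4" using Suc by (simp add: mod_Suc_eq)
    finally show ?case by simp
  qed simp
  then have "f (l - 1) mod 4 = (f 0 + (l - 1)) mod 4" using assms(1) by simp
  moreover have "f 0 mod 4 = Suc (f (l - 1)) mod 4" using step[of "l - 1"] assms(1) by simp
  ultimately have "f 0 mod 4 = (f 0 + Suc (l - 1)) mod 4" by (metis add_Suc_right mod_Suc_eq)
  then have "4 dvd Suc (l - 1)" by (metis add_diff_cancel_left' le_add1 mod_eq_dvd_iff_nat)
  then show False using assms by simp
qed

lemma card_copies_dicycle_4_blowup4: "(n div 4) ^ 4 \<le> card (copies (dicycle 4) (blowup4 n))"
proof -
  let ?X = "{..<4::nat} \<rightarrow>\<^sub>E {..<n div 4}"
  \<comment> \<open>The vertex number \<open>x i\<close> of the class \<open>i\<close>; one vertex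
    from each class spans a 4-cycle, and residues recover the choice from the vertex set.\<close>
  define f where "f x i = 4 * x i + i" for x :: "nat \<Rightarrow> nat" and i
  have rec: "i = j \<and> x i = y j" if "f x i = f y j" "i < 4" "j < 4" for x y i j
  proof -
    have "i = j" using arg_cong[OF that(1), of "\<lambda>k. k mod 4"] that(2,3) by (simp add: f_def)
    then show ?thesis using that by (simp add: f_def)
  qed
  have "inj_on (\<lambda>x. cycle_image 4 (f x)) ?X"
  proof (rule inj_onI)
    fix x y assume x: "x \<in> ?X" and y: "y \<in> ?X" and "cycle_image 4 (f x) = cycle_image 4 (f y)"
    then have eq: "f x ` {..<4} = f y ` {..<4}" by (simp add: cycle_image_def)
    have "x i = y i" if i: "i \<in> {..<4}" for i
    proof -
      have "f x i \<in> f y ` {..<4}" using eq i by blast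
      then show ?thesis using rec i by blast
    qed
    then show "x = y" using PiE_ext[OF x y] by blast
  qed
  moreover have "(\<lambda>x. cycle_image 4 (f x)) ` ?X \<subseteq> copies (dicycle 4) (blowup4 n)"
  proof clarify
    fix x assume x: "x \<in> ?X"
    have "f x i < n" if "i < 4" for i
    proof -
      have "x i < n div 4" using x that by auto
      then show ?thesis using that unfolding f_def by linarith
    qed
    then have "cyclic_walk (parcs (blowup4 n)) 4 (f x)"
      by (auto simp: cyclic_walk_def blowup4_def f_def mod_Suc)
    moreover have "inj_on (f x) {..<4}" using rec by (intro inj_onI) blast
    ultimately show "cycle_image 4 (f x) \<in> copies (dicycle 4) (blowup4 n)"
      using mem_copies_dicycle_iff[OF oriented_graphD(1)[OF oriented_blowup4], of 4] by auto
  qed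
  ultimately have "card ?X \<le> card (copies (dicycle 4) (blowup4 n))"
    using card_inj_on_le finite_copies[OF oriented_blowup4] by blast
  then show ?thesis by (simp add: card_PiE)
qed

lemma ex_count_dicycle_4_ge:
  assumes "l > 0" "\<not> 4 dvd l"
  shows "(n div 4) ^ 4 \<le> ex_count n (dicycle 4) (dicycle l)"
proof -
  have "card (copies (dicycle 4) (blowup4 n)) \<le> ex_count n (dicycle 4) (dicycle l)"
    unfolding ex_count_def using oriented_blowup4 copies_dicycle_blowup4[OF assms]
    by (intro Max_ge ex_count_set_finite) (auto simp: blowup4_def)
  with card_copies_dicycle_4_blowup4 show ?thesis by (rule order_trans)
qed

section \<open>Asymptotics of the extremal number\<close>

lemma ex_count_dicycle_4_le:
  assumes l: "l > 4" "\<not> 4 dvd l" and \<epsilon>: "\<epsilon> > 0"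
  obtains n0 where "\<And>n. n \<ge> n0 \<Longrightarrow>
    real (ex_count n (dicycle 4) (dicycle l)) \<le> (real n / 4) ^ 4 + \<epsilon> * real n ^ 4"
proof -
  \<comment> \<open>With four closed walks per copy, the error \<open>4 * \<epsilon>\<close> for
    closed walks becomes \<open>\<epsilon>\<close> for copies.\<close>
  obtain n0 where n0: "\<And>V (E :: nat rel). finite V \<Longrightarrow> E \<subseteq> V \<times> V \<Longrightarrow> (\<And>u v. (u, v) \<in> E \<Longrightarrow> (v, u) \<notin> E) \<Longrightarrow>
     (\<And>f. cyclic_walk E l f \<Longrightarrow> \<not> inj_on f {..<l}) \<Longrightarrow> card V \<ge> n0 \<Longrightarrow>
     real (card (closed4 E)) \<le> (1 / 64 + 4 * \<epsilon>) * real (card V) ^ 4"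
    using card_closed4_asymptotic[OF l, of "4 * \<epsilon>"] \<epsilon> by (metis zero_less_mult_iff zero_less_numeral)
  show ?thesis
  proof (rule that[of n0])
    fix n assume n: "n \<ge> n0"
    let ?S = "{card (copies (dicycle 4) G) | G :: nat pair_pre_digraph.
            oriented_graph G \<and> card (pverts G) = n \<and> copies (dicycle l) G = {}}"
    have "ex_count n (dicycle 4) (dicycle l) \<in> ?S"
      unfolding ex_count_def using l
      by (intro Max_in ex_count_set_finite ex_count_set_nonempty) (auto simp: dicycle_def)
    then obtain G :: "nat pair_pre_digraph" where G: "oriented_graph G" "card (pverts G) = n"
      "copies (dicycle l) G = {}" and ex: "ex_count n (dicycle 4) (dicycle l) = card (copies (dicycle 4) G)"
      by auto
    have noinj: "\<not> inj_on f {..<l}" if "cyclic_walk (parcs G) l f" for f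
      using mem_copies_dicycle_iff[of G l "cycle_image l f"] oriented_graphD(1)[OF G(1)] that G(3) l
      by auto
    have "real (card (closed4 (parcs G))) \<le> (1 / 64 + 4 * \<epsilon>) * real (card (pverts G)) ^ 4"
      using oriented_graphD[OF G(1)] noinj G(2) n by (intro n0) auto
    moreover have "4 * real (card (copies (dicycle 4) G)) \<le> real (card (closed4 (parcs G)))"
      using card_copies_dicycle_4[OF G(1)] by (metis of_nat_le_iff of_nat_mult of_nat_numeral)
    ultimately show "real (ex_count n (dicycle 4) (dicycle l)) \<le> (real n / 4) ^ 4 + \<epsilon> * real n ^ 4"
      unfolding ex G(2) by (simp add: power_divide algebra_simps)
  qed
qed

theorem theorem3p12:
  fixes l :: nat
  assumes "l > 4" and "\<not> 4 dvd l"
  shows "(\<lambda>n. real (ex_count n (dicycle 4) (dicycle l)) - (real n / 4) ^ 4) \<in> o(\<lambda>n. real n ^ 4)"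
proof (rule landau_o.smallI)
  fix \<epsilon> :: real assume \<epsilon>: "\<epsilon> > 0"
  let ?ex = "\<lambda>n. real (ex_count n (dicycle 4) (dicycle l))"
  obtain n0 where n0: "\<And>n. n \<ge> n0 \<Longrightarrow> ?ex n \<le> (real n / 4) ^ 4 + \<epsilon> * real n ^ 4"
    using ex_count_dicycle_4_le[OF assms \<epsilon>] by blast
  \<comment> \<open>Rounding \<open>n / 4\<close> down costs at most the fraction
    \<open>16 / n\<close> of the main term, and this choice makes it at most
    \<open>256 * \<epsilon>\<close>, that is \<open>\<epsilon> * n ^ 4\<close> in total. The bound
    \<open>n \<ge> 4\<close> imposed below serves Bernoulli's inequality and keeps
    \<open>n / 4 - 1\<close> nonnegative.\<close>
  obtain n1 :: nat where n1: "real n1 \<ge> 1 / (16 * \<epsilon>)" using real_arch_simple by blast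
  have "norm (?ex n - (real n / 4) ^ 4) \<le> \<epsilon> * norm (real n ^ 4)" if n: "n \<ge> max (max n0 n1) 4" for n
  proof -
    have "16 / real n \<le> 256 * \<epsilon>"
    proof -
      have "1 / (16 * \<epsilon>) \<le> real n" using n n1 by linarith
      then show ?thesis using \<epsilon> n by (simp add: field_simps)
    qed
    moreover have "1 - 16 / real n \<le> (1 - 4 / real n) ^ 4"
      using Bernoulli_inequality[of "- (4 / real n)" 4] n by (simp add: field_simps)
    ultimately have "1 - 256 * \<epsilon> \<le> (1 - 4 / real n) ^ 4" by linarith
    then have "(real n / 4) ^ 4 * (1 - 256 * \<epsilon>) \<le> (real n / 4) ^ 4 * (1 - 4 / real n) ^ 4"
      by (intro mult_left_mono) auto
    also have "\<dots> = (real n / 4 - 1) ^ 4"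
      using n by (simp add: field_simps flip: power_mult_distrib)
    also have "\<dots> \<le> real (n div 4) ^ 4"
    proof (intro power_mono)
      have "n \<le> 4 * (n div 4) + 4" by linarith
      then show "real n / 4 - 1 \<le> real (n div 4)" by linarith
    qed (use n in auto)
    also have "\<dots> \<le> ?ex n"
      using ex_count_dicycle_4_ge[of l n] assms by (simp flip: of_nat_power)
    finally have "(real n / 4) ^ 4 - \<epsilon> * real n ^ 4 \<le> ?ex n"
      by (simp add: power_divide algebra_simps)
    then show ?thesis using n0[of n] n by (simp add: abs_le_iff)
  qed
  then show "\<forall>\<^sub>F n in sequentially. norm (?ex n - (real n / 4) ^ 4) \<le> \<epsilon> * norm (real n ^ 4)"
    by (rule eventually_sequentiallyI)
qed

end
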